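(* Let $k$ be a field, let $\Delta$ be a simplicial complex on $[n]$ and let $I=I_\Delta\subseteq R=k[x_1,\ldots,x_n]$ be its Stanley--Reisner ideal. For $\ell\ge1$, let $(T_\ell)$ be the condition: every element $m$ of $G(I^{(\ell)})$ can be written as $m=m_1\cdots m_s$, where each $m_i$ is a squarefree monomial in $G(I^{(c_i)})$ for some $1\le c_i\le \operatorname{ht} I$, with $\sum_{i=1}^s c_i=\ell$ and $\operatorname{supp}(m_1)\supseteq\cdots\supseteq\operatorname{supp}(m_s)$. The following are equivalent: (1) $\Delta$ is a matroid; (2) $(T_\ell)$ holds for all $\ell\ge 1$; (3) $(T_\ell)$ holds for some $\ell\ge 2$; (4) $G(I^{(2)})=\{m_1^2,\ldots,m_r^2\}\cup G(SF_2(I))$, where $G(I)=\{m_1,\ldots,m_r\}$ and $SF_2(I)$ is the ideal generated by the squarefree monomials in $I^{(2)}$.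
   Context: Simplicial complexes on $[n]=\{1,\ldots,n\}$ are nonempty and a one-element subset of $[n]$ need not be a face. A simplicial complex "is a matroid" if its facets are the bases of a matroid on $[n]$. For $F\subseteq[n]$ put $\mathfrak p_F=(x_i: i\in F)$. The Stanley--Reisner ideal is $I_\Delta=\bigcap_F \mathfrak p_{[n]-F}$, intersection over the facets $F$ of $\Delta$. For a squarefree monomial ideal $I$, $I^{(\ell)}=\bigcap_{\mathfrak p\in\operatorname{Ass}(R/I)}\mathfrak p^\ell$. For a monomial ideal $L$, $G(L)$ denotes its unique minimal generating set consisting of monomials. For a monomial $m$, $\operatorname{supp}(m)$ is the set of variables dividing $m$. $\operatorname{ht} I$ is the height of $I$. *)

theory Defs
  imports
    "HOL-Library.Poly_Mapping"
    "HOL-Library.Extended_Nat"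
    "HOL-Algebra.QuotRing"
    "HOL-Algebra.Ideal_Product"
    "HOL-Algebra.Divisibility"
begin

section \<open>The polynomial ring\<close>

text \<open>A polynomial is a finitely supported function from exponent vectors to coefficients;
  the product of the type is the convolution product. The ring in \<open>n\<close> variables consists of
  the polynomials that only involve variables with index in \<open>{1..n}\<close>.\<close>

type_synonym 'k mpoly = "(nat \<Rightarrow>\<^sub>0 nat) \<Rightarrow>\<^sub>0 'k"

definition poly_ring :: "nat \<Rightarrow> 'k::field mpoly ring" where
  "poly_ring n =
    \<lparr>carrier = {p. \<forall>t\<in>Poly_Mapping.keys p. Poly_Mapping.keys t \<subseteq> {1..n}},
     monoid.mult = (*), one = 1, zero = 0, add = (+)\<rparr>"

definition var :: "nat \<Rightarrow> 'k::field mpoly" where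
  "var i = Poly_Mapping.single (Poly_Mapping.single i 1) 1"

definition monomials :: "nat \<Rightarrow> 'k::field mpoly set" where
  "monomials n = {Poly_Mapping.single t 1 | t. Poly_Mapping.keys t \<subseteq> {1..n}}"

definition sqfree_monomials :: "nat \<Rightarrow> 'k::field mpoly set" where
  "sqfree_monomials n =
    {Poly_Mapping.single t 1 | t. Poly_Mapping.keys t \<subseteq> {1..n} \<and> (\<forall>i. Poly_Mapping.lookup t i \<le> 1)}"

text \<open>Variables are identified with their indices.\<close>

definition supp :: "nat \<Rightarrow> 'k::field mpoly \<Rightarrow> nat set" where
  "supp n m = {i \<in> {1..n}. var i divides\<^bsub>poly_ring n\<^esub> m}"

section \<open>Height, associated primes, symbolic powers\<close>

definition prime_height :: "('a, 'b) ring_scheme \<Rightarrow> 'a set \<Rightarrow> enat" where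
  "prime_height R P =
    Sup {enat h | h. \<exists>Q :: nat \<Rightarrow> 'a set.
      (\<forall>i\<le>h. primeideal (Q i) R) \<and> (\<forall>i<h. Q i \<subset> Q (Suc i)) \<and> Q h = P}"

definition height :: "('a, 'b) ring_scheme \<Rightarrow> 'a set \<Rightarrow> enat" where
  "height R I = Inf {prime_height R P | P. primeideal P R \<and> I \<subseteq> P}"

text \<open>The associated primes of the \<open>R\<close>-module \<open>R/I\<close>: the prime ideals that are the annihilator
  of some element \<open>z\<close>. The scalar \<open>r\<close> acts on \<open>R/I\<close> as multiplication by the coset \<open>I + r\<close>.\<close>

definition Ass :: "('a, 'b) ring_scheme \<Rightarrow> 'a set \<Rightarrow> 'a set set" where
  "Ass R I = {P. primeideal P R \<and>
    (\<exists>z \<in> carrier (R Quot I).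
      P = {r \<in> carrier R. (I +>\<^bsub>R\<^esub> r) \<otimes>\<^bsub>R Quot I\<^esub> z = \<zero>\<^bsub>R Quot I\<^esub>})}"

text \<open>\<open>P [^]\<^bsub>ideals_set R\<^esub> l\<close> is the ordinary \<open>l\<close>-th power of the ideal \<open>P\<close>.
  Meeting with the carrier only matters when there are no associated primes.\<close>

definition symb_pow :: "('a, 'b) ring_scheme \<Rightarrow> 'a set \<Rightarrow> nat \<Rightarrow> 'a set" where
  "symb_pow R I l = carrier R \<inter> (\<Inter>P\<in>Ass R I. P [^]\<^bsub>ideals_set R\<^esub> l)"

section \<open>Monomial ideals\<close>

definition minimal_monomial_gens :: "nat \<Rightarrow> 'k::field mpoly set \<Rightarrow> 'k mpoly set \<Rightarrow> bool" where
  "minimal_monomial_gens n L S \<longleftrightarrow>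
    S \<subseteq> monomials n \<and> Idl\<^bsub>poly_ring n\<^esub> S = L \<and> (\<forall>S'. S' \<subset> S \<longrightarrow> Idl\<^bsub>poly_ring n\<^esub> S' \<noteq> L)"

text \<open>Meaningful for monomial ideals \<open>L\<close>, where the minimal set of monomial generators exists
  and is unique.\<close>

definition mingens :: "nat \<Rightarrow> 'k::field mpoly set \<Rightarrow> 'k mpoly set" where
  "mingens n L = (THE S. minimal_monomial_gens n L S)"

definition SF2 :: "nat \<Rightarrow> 'k::field mpoly set \<Rightarrow> 'k mpoly set" where
  "SF2 n I = Idl\<^bsub>poly_ring n\<^esub> (sqfree_monomials n \<inter> symb_pow (poly_ring n) I 2)"

section \<open>Simplicial complexes and matroids\<close>

definition simplicial_complex :: "nat \<Rightarrow> nat set set \<Rightarrow> bool" where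
  "simplicial_complex n \<Delta> \<longleftrightarrow>
    \<Delta> \<noteq> {} \<and> \<Delta> \<subseteq> Pow {1..n} \<and> (\<forall>F\<in>\<Delta>. \<forall>F'. F' \<subseteq> F \<longrightarrow> F' \<in> \<Delta>)"

definition facets :: "nat set set \<Rightarrow> nat set set" where
  "facets \<Delta> = {F \<in> \<Delta>. \<forall>F'\<in>\<Delta>. F \<subseteq> F' \<longrightarrow> F' = F}"

text \<open>\<open>\<B>\<close> is the set of bases of a matroid on \<open>E\<close> (basis exchange axiom).\<close>

definition matroid_bases :: "'e set \<Rightarrow> 'e set set \<Rightarrow> bool" where
  "matroid_bases E \<B> \<longleftrightarrow>
    finite E \<and> \<B> \<noteq> {} \<and> \<B> \<subseteq> Pow E \<and>
    (\<forall>A\<in>\<B>. \<forall>B\<in>\<B>. \<forall>a\<in>A - B. \<exists>b\<in>B - A. insert b (A - {a}) \<in> \<B>)"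

definition is_matroid :: "nat \<Rightarrow> nat set set \<Rightarrow> bool" where
  "is_matroid n \<Delta> \<longleftrightarrow> matroid_bases {1..n} (facets \<Delta>)"

section \<open>Stanley--Reisner ideals and the condition on symbolic powers\<close>

definition var_prime :: "nat \<Rightarrow> nat set \<Rightarrow> 'k::field mpoly set" where
  "var_prime n F = Idl\<^bsub>poly_ring n\<^esub> (var ` F)"

definition stanley_reisner :: "nat \<Rightarrow> nat set set \<Rightarrow> 'k::field mpoly set" where
  "stanley_reisner n \<Delta> = (\<Inter>F\<in>facets \<Delta>. var_prime n ({1..n} - F))"

definition cond_T :: "nat \<Rightarrow> 'k::field mpoly set \<Rightarrow> nat \<Rightarrow> bool" where
  "cond_T n I l \<longleftrightarrow>
    (\<forall>m \<in> mingens n (symb_pow (poly_ring n) I l).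
      \<exists>s (f :: nat \<Rightarrow> 'k mpoly) (c :: nat \<Rightarrow> nat).
        m = (\<Prod>i=1..s. f i) \<and>
        (\<forall>i\<in>{1..s}. 1 \<le> c i \<and> enat (c i) \<le> height (poly_ring n) I \<and>
          f i \<in> sqfree_monomials n \<and> f i \<in> mingens n (symb_pow (poly_ring n) I (c i))) \<and>
        (\<Sum>i=1..s. c i) = l \<and>
        (\<forall>i. 1 \<le> i \<and> i < s \<longrightarrow> supp n (f (Suc i)) \<subseteq> supp n (f i)))"

end

theory Submission
  imports Defs
begin

text \<open>The monomials of \<open>I\<^sup>(\<^sup>l\<^sup>)\<close> are the weightings of the vertices that give every facet complement
  weight at least \<open>l\<close>, so everything reduces to minimal such weightings.

  If \<open>\<Delta>\<close> is a matroid, take the level sets \<open>A\<^sub>i\<close> of a minimal weighting. By the greedy algorithm, a facet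
  of maximal weight meets all the \<open>A\<^sub>i\<close> simultaneously in as many elements as possible; hence the
  indicators of the \<open>A\<^sub>i\<close> form the required decomposition, with \<open>c\<^sub>i\<close> the minimal number of elements
  of \<open>A\<^sub>i\<close> in a facet complement.

  Conversely, if circuit elimination fails for the minimal nonfaces \<open>K\<^sub>1 \<noteq> K\<^sub>2\<close> at \<open>e\<close>, let \<open>t\<close> be a minimal
  weighting below \<open>K\<^sub>1 + (l - 1) K\<^sub>2\<close>. A facet containing \<open>K\<^sub>1 \<union> K\<^sub>2 - {e}\<close> shows that \<open>e\<close> has weight \<open>l\<close>
  in \<open>t\<close> and that all \<open>c\<^sub>i = 1\<close>. The factors are then nested minimal nonfaces, hence all equal, and
  \<open>t = l K\<close> with a nonface \<open>K \<subseteq> K\<^sub>1 \<inter> K\<^sub>2\<close>, which is absurd. Condition (4) is \<open>(T\<^sub>2)\<close> spelled out.\<close>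

section \<open>Monomial ideals\<close>

abbreviation mon :: "(nat \<Rightarrow>\<^sub>0 nat) \<Rightarrow> 'k::field mpoly" where
  "mon t \<equiv> Poly_Mapping.single t 1"

definition exps :: "nat \<Rightarrow> (nat \<Rightarrow>\<^sub>0 nat) set" where
  "exps n = {t. Poly_Mapping.keys t \<subseteq> {1..n}}"

text \<open>The order relation \<open>\<le>\<close> that the library puts on exponent vectors is lexicographic.\<close>

definition le_exp :: "(nat \<Rightarrow>\<^sub>0 nat) \<Rightarrow> (nat \<Rightarrow>\<^sub>0 nat) \<Rightarrow> bool" where
  "le_exp s t \<longleftrightarrow> (\<forall>i. Poly_Mapping.lookup s i \<le> Poly_Mapping.lookup t i)"

definition up :: "nat \<Rightarrow> (nat \<Rightarrow>\<^sub>0 nat) set \<Rightarrow> (nat \<Rightarrow>\<^sub>0 nat) set" where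
  "up n T = {t \<in> exps n. \<exists>s\<in>T. le_exp s t}"

definition mins :: "(nat \<Rightarrow>\<^sub>0 nat) set \<Rightarrow> (nat \<Rightarrow>\<^sub>0 nat) set" where
  "mins U = {t \<in> U. \<forall>s\<in>U. le_exp s t \<longrightarrow> s = t}"

text \<open>For up-closed \<open>U\<close> this is the monomial ideal whose monomials have exponents
  in \<open>U\<close>; inclusions and intersections of such ideals are then computed on exponent
  sets.\<close>

definition mspan :: "(nat \<Rightarrow>\<^sub>0 nat) set \<Rightarrow> 'k::field mpoly set" where
  "mspan U = {p. Poly_Mapping.keys p \<subseteq> U}"

text \<open>The degree of a monomial in the variables of \<open>C\<close>: the largest power of the
  prime generated by these variables that contains the monomial.\<close>

definition wt :: "nat set \<Rightarrow> (nat \<Rightarrow>\<^sub>0 nat) \<Rightarrow> nat" where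
  "wt C t = (\<Sum>i\<in>C. Poly_Mapping.lookup t i)"

section \<open>Exponent vectors under divisibility\<close>

lemma le_exp_refl: "le_exp t t"
  by (simp add: le_exp_def)

lemma le_exp_trans: "le_exp r s \<Longrightarrow> le_exp s t \<Longrightarrow> le_exp r t"
  unfolding le_exp_def by (meson order_trans)

lemma le_exp_add: "le_exp s (u + s)"
  by (simp add: le_exp_def lookup_add)

text \<open>Subtraction is truncated at 0 in each coordinate; below \<open>t\<close> nothing is cut
  off, so \<open>t - s\<close> is the exponent of the quotient of the two monomials.\<close>

lemma le_exp_diff: "le_exp s t \<Longrightarrow> t = (t - s) + s"
  by (rule poly_mapping_eqI) (simp add: le_exp_def lookup_add lookup_minus)

lemma keys_exp_add: "Poly_Mapping.keys (s + t) = Poly_Mapping.keys s \<union> Poly_Mapping.keys (t :: nat \<Rightarrow>\<^sub>0 nat)"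
  by (auto simp: in_keys_iff lookup_add)

lemma exps_add [simp]: "s + t \<in> exps n \<longleftrightarrow> s \<in> exps n \<and> t \<in> exps n"
  by (simp add: exps_def keys_exp_add)

lemma exps_zero [simp]: "0 \<in> exps n"
  by (simp add: exps_def)

lemma exps_mono: "le_exp s t \<Longrightarrow> t \<in> exps n \<Longrightarrow> s \<in> exps n"
  using exps_add le_exp_diff by metis

lemma exps_diff: "t \<in> exps n \<Longrightarrow> t - s \<in> exps n"
  by (auto simp: exps_def in_keys_iff lookup_minus)

lemma wt_add: "wt C (s + t) = wt C s + wt C t"
  by (simp add: wt_def lookup_add sum.distrib)

lemma wt_mono: "le_exp s t \<Longrightarrow> wt C s \<le> wt C t"
  by (simp add: wt_def le_exp_def sum_mono)

section \<open>The polynomial ring as a span of monomials\<close>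

lemma carrier_poly_ring: "carrier (poly_ring n) = mspan (exps n)"
  by (auto simp: poly_ring_def mspan_def exps_def)

lemma mult_poly_ring [simp]: "p \<otimes>\<^bsub>poly_ring n\<^esub> q = p * q"
  and one_poly_ring [simp]: "\<one>\<^bsub>poly_ring n\<^esub> = 1"
  and zero_poly_ring [simp]: "\<zero>\<^bsub>poly_ring n\<^esub> = 0"
  and add_poly_ring [simp]: "p \<oplus>\<^bsub>poly_ring n\<^esub> q = p + q"
  by (simp_all add: poly_ring_def)

lemma mspan_zero [simp]: "0 \<in> mspan U"
  by (simp add: mspan_def)

lemma mspan_add: "p \<in> mspan U \<Longrightarrow> q \<in> mspan U \<Longrightarrow> p + q \<in> mspan U"
  unfolding mspan_def using Poly_Mapping.keys_add[of p q] by blast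

lemma mspan_uminus: "p \<in> mspan U \<Longrightarrow> - p \<in> mspan U"
  by (simp add: mspan_def)

lemma mspan_diff: "p \<in> mspan U \<Longrightarrow> q \<in> mspan U \<Longrightarrow> p - q \<in> mspan U"
  unfolding mspan_def using Poly_Mapping.keys_diff[of p q] by blast

lemma mspan_sum: "(\<And>i. i \<in> A \<Longrightarrow> f i \<in> mspan U) \<Longrightarrow> sum f A \<in> mspan U"
  by (induction A rule: infinite_finite_induct) (auto intro: mspan_add)

lemma mspan_mult:
  assumes "p \<in> mspan U" "q \<in> mspan V" "\<And>s t. s \<in> U \<Longrightarrow> t \<in> V \<Longrightarrow> s + t \<in> W"
  shows "p * q \<in> mspan W"
  using assms keys_mult[of p q] unfolding mspan_def by blast

lemma single_mem_mspan: "c = 0 \<or> t \<in> U \<Longrightarrow> Poly_Mapping.single t c \<in> mspan U"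
  by (auto simp: mspan_def)

lemma mon_mem_mspan [simp]: "mon t \<in> mspan U \<longleftrightarrow> t \<in> U"
  by (simp add: mspan_def)

lemma mspan_mono: "U \<subseteq> V \<Longrightarrow> mspan U \<subseteq> mspan V"
  by (auto simp: mspan_def)

lemma mspan_subset_iff: "(mspan U :: 'k::field mpoly set) \<subseteq> mspan V \<longleftrightarrow> U \<subseteq> V"
proof
  assume *: "(mspan U :: 'k mpoly set) \<subseteq> mspan V"
  show "U \<subseteq> V"
  proof
    fix t assume "t \<in> U"
    then have "(mon t :: 'k mpoly) \<in> mspan V" using * by (metis mon_mem_mspan subsetD)
    then show "t \<in> V" by simp
  qed
qed (rule mspan_mono)

lemma mspan_eq_iff: "(mspan U :: 'k::field mpoly set) = mspan V \<longleftrightarrow> U = V"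
  by (simp add: set_eq_subset mspan_subset_iff)

lemma mpoly_sum_monomials: "p = (\<Sum>t\<in>Poly_Mapping.keys p. Poly_Mapping.single t (Poly_Mapping.lookup p t))"
  by (rule poly_mapping_eqI)
    (auto simp: lookup_sum lookup_single when_def in_keys_iff sum.delta)

lemma cring_poly_ring: "cring (poly_ring n :: 'k::field mpoly ring)"
proof (rule cringI)
  show "abelian_group (poly_ring n :: 'k mpoly ring)"
  proof (rule abelian_groupI)
    fix p :: "'k mpoly" assume "p \<in> carrier (poly_ring n)"
    then show "\<exists>y\<in>carrier (poly_ring n). y \<oplus>\<^bsub>poly_ring n\<^esub> p = \<zero>\<^bsub>poly_ring n\<^esub>"
      by (intro bexI[of _ "- p"]) (auto simp: carrier_poly_ring intro: mspan_uminus)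
  qed (auto simp: carrier_poly_ring ac_simps intro: mspan_add)
  show "Group.comm_monoid (poly_ring n :: 'k mpoly ring)"
  proof (rule comm_monoidI)
    show "\<one>\<^bsub>poly_ring n\<^esub> \<in> carrier (poly_ring n :: 'k mpoly ring)"
      by (simp add: carrier_poly_ring mspan_def)
  qed (auto simp: carrier_poly_ring ac_simps intro: mspan_mult)
qed (simp add: distrib_right)

lemma ring_poly_ring: "ring (poly_ring n :: 'k::field mpoly ring)"
  using cring_poly_ring by (rule cring.axioms)

section \<open>Monomial ideals as up-closed sets of exponents\<close>

definition upset :: "nat \<Rightarrow> (nat \<Rightarrow>\<^sub>0 nat) set \<Rightarrow> bool" where
  "upset n U \<longleftrightarrow> U \<subseteq> exps n \<and> (\<forall>s\<in>U. \<forall>t\<in>exps n. le_exp s t \<longrightarrow> t \<in> U)"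

lemma upset_up: "upset n (up n T)"
  unfolding upset_def up_def using le_exp_trans by blast

lemma upset_add: "upset n U \<Longrightarrow> t \<in> U \<Longrightarrow> s \<in> exps n \<Longrightarrow> s + t \<in> U"
  unfolding upset_def using le_exp_add exps_add by blast

lemma upset_wt: "upset n {t \<in> exps n. l \<le> wt C t}"
  unfolding upset_def using wt_mono order_trans by blast

lemma ideal_mspan:
  assumes "upset n U"
  shows "ideal (mspan U :: 'k::field mpoly set) (poly_ring n)"
proof (rule idealI)
  have U: "mspan U \<subseteq> (mspan (exps n) :: 'k mpoly set)"
    using assms by (simp add: mspan_subset_iff upset_def)
  show "subgroup (mspan U :: 'k mpoly set) (add_monoid (poly_ring n))"
  proof (rule group.subgroupI)
    show "group (add_monoid (poly_ring n :: 'k mpoly ring))"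
      by (intro abelian_group.a_group ring.is_abelian_group ring_poly_ring)
    show "mspan U \<subseteq> (carrier (add_monoid (poly_ring n)) :: 'k mpoly set)"
      using U by (simp add: carrier_poly_ring)
    show "(mspan U :: 'k mpoly set) \<noteq> {}" using mspan_zero by blast
    fix p q :: "'k mpoly" assume p: "p \<in> mspan U" and q: "q \<in> mspan U"
    interpret ring "poly_ring n :: 'k mpoly ring" by (rule ring_poly_ring)
    have "\<ominus>\<^bsub>poly_ring n\<^esub> p = - p"
      using p U mspan_uminus[of p "exps n"] by (intro minus_equality) (auto simp: carrier_poly_ring)
    then show "inv\<^bsub>add_monoid (poly_ring n)\<^esub> p \<in> mspan U"
      using mspan_uminus[OF p] by (simp add: a_inv_def)
    show "p \<otimes>\<^bsub>add_monoid (poly_ring n)\<^esub> q \<in> mspan U"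
      using mspan_add[OF p q] by simp
  qed
  fix p x :: "'k mpoly" assume p: "p \<in> mspan U" and x: "x \<in> carrier (poly_ring n)"
  have "x * p \<in> mspan U"
    using x[unfolded carrier_poly_ring] p by (rule mspan_mult) (use upset_add[OF assms] in auto)
  then show "x \<otimes>\<^bsub>poly_ring n\<^esub> p \<in> mspan U" "p \<otimes>\<^bsub>poly_ring n\<^esub> x \<in> mspan U"
    by (simp_all add: mult.commute)
qed (rule ring_poly_ring)

lemma ideal_sum_closed:
  assumes "ideal J (poly_ring n :: 'k::field mpoly ring)" "\<And>i. i \<in> A \<Longrightarrow> f i \<in> J"
  shows "sum f A \<in> J"
  using assms(2)
proof (induction A rule: infinite_finite_induct)
  case (insert x F)
  then show ?case
    using additive_subgroup.a_closed[OF ideal.axioms(1)[OF assms(1)], of "f x" "sum f F"] by simp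
qed (use additive_subgroup.zero_closed[OF ideal.axioms(1)[OF assms(1)]] in simp_all)

text \<open>A polynomial is the sum of its terms, and each term is a constant times a monomial of
  \<open>J\<close>.\<close>

lemma mspan_subset_ideal:
  assumes J: "ideal J (poly_ring n :: 'k::field mpoly ring)" and "\<And>t. t \<in> U \<Longrightarrow> mon t \<in> J"
  shows "mspan U \<subseteq> J"
proof
  fix p :: "'k mpoly" assume p: "p \<in> mspan U"
  show "p \<in> J"
  proof (subst mpoly_sum_monomials, rule ideal_sum_closed[OF J])
    fix t assume "t \<in> Poly_Mapping.keys p"
    then have "mon t \<in> J" using p assms(2) by (auto simp: mspan_def)
    then have "Poly_Mapping.single 0 (Poly_Mapping.lookup p t) \<otimes>\<^bsub>poly_ring n\<^esub> mon t \<in> J"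
      by (intro ideal.I_l_closed[OF J]) (simp_all add: carrier_poly_ring single_mem_mspan)
    then show "Poly_Mapping.single t (Poly_Mapping.lookup p t) \<in> J"
      by (simp add: mult_single)
  qed
qed

text \<open>The span on the right is an ideal containing the generators. Conversely,
  \<open>t\<close> in \<open>up n T\<close> is \<open>(t - s) + s\<close> with \<open>s\<close> in
  \<open>T\<close>, so its monomial is a multiple of a generator.\<close>

lemma genideal_mon:
  assumes "T \<subseteq> exps n"
  shows "Idl\<^bsub>poly_ring n\<^esub> (mon ` T) = (mspan (up n T) :: 'k::field mpoly set)"
proof
  interpret ring "poly_ring n :: 'k mpoly ring" by (rule ring_poly_ring)
  have T: "T \<subseteq> up n T" using assms le_exp_refl by (auto simp: up_def)
  then show "Idl\<^bsub>poly_ring n\<^esub> (mon ` T) \<subseteq> (mspan (up n T) :: 'k mpoly set)"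
    by (intro genideal_minimal ideal_mspan upset_up) auto
  have sub: "mon ` T \<subseteq> carrier (poly_ring n :: 'k mpoly ring)"
    using assms by (auto simp: carrier_poly_ring)
  note J = genideal_ideal[OF sub]
  show "mspan (up n T) \<subseteq> (Idl\<^bsub>poly_ring n\<^esub> (mon ` T) :: 'k mpoly set)"
  proof (rule mspan_subset_ideal[OF J])
    fix t assume "t \<in> up n T"
    then obtain s where t: "t \<in> exps n" "s \<in> T" "le_exp s t" by (auto simp: up_def)
    have "(mon (t - s) :: 'k mpoly) \<otimes>\<^bsub>poly_ring n\<^esub> mon s \<in> Idl\<^bsub>poly_ring n\<^esub> (mon ` T)"
      using genideal_self[OF sub] t by (intro ideal.I_l_closed[OF J]) (auto simp: carrier_poly_ring exps_diff)
    then show "(mon t :: 'k mpoly) \<in> Idl\<^bsub>poly_ring n\<^esub> (mon ` T)"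
      by (simp add: mult_single flip: le_exp_diff[OF t(3)])
  qed
qed

section \<open>Minimal monomial generators\<close>

text \<open>Descent on the total degree, which drops when passing to a proper divisor.\<close>

lemma mins_below:
  assumes "upset n U" "t \<in> U"
  shows "\<exists>s\<in>mins U. le_exp s t"
  using assms(2)
proof (induction "wt {1..n} t" arbitrary: t rule: less_induct)
  case less
  show ?case
  proof (cases "t \<in> mins U")
    case False
    then obtain s where s: "s \<in> U" "le_exp s t" "s \<noteq> t" using less.prems by (auto simp: mins_def)
    have "t - s \<noteq> 0" using le_exp_diff[OF s(2)] s(3) by auto
    then obtain i where i: "Poly_Mapping.lookup (t - s) i \<noteq> 0"
      using poly_mapping_eqI[of "t - s" 0] by auto
    have "t \<in> exps n" using less.prems assms by (auto simp: upset_def)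
    then have "i \<in> {1..n}" using i exps_diff[of t n s] in_keys_iff[of i "t - s"] unfolding exps_def by blast
    then have "wt {1..n} (t - s) \<noteq> 0" using i by (auto simp: wt_def)
    then have "wt {1..n} s < wt {1..n} t"
      using le_exp_diff[OF s(2)] wt_add[of "{1..n}" "t - s" s] by simp
    then show ?thesis using less.hyps s le_exp_trans by blast
  qed (use le_exp_refl in blast)
qed

lemma up_mins: "upset n U \<Longrightarrow> up n (mins U) = U"
  using mins_below by (force simp: up_def mins_def upset_def)

text \<open>A minimal exponent lies above some generator, which itself belongs to \<open>U\<close>,
  so the two coincide. This is what makes the minimal monomial generating set unique.\<close>

lemma mins_subset_gens:
  assumes "up n T = U" "T \<subseteq> exps n"
  shows "mins U \<subseteq> T"
proof
  fix t assume t: "t \<in> mins U"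
  then obtain s where s: "s \<in> T" "le_exp s t" using assms by (auto simp: mins_def up_def)
  then have "s \<in> U" using assms le_exp_refl by (auto simp: up_def)
  then show "t \<in> T" using t s by (auto simp: mins_def)
qed

lemma inj_mon: "inj (mon :: _ \<Rightarrow> 'k::field mpoly)"
  by (auto intro!: injI dest: arg_cong[where f = Poly_Mapping.keys])

lemma mingens_mspan:
  assumes U: "upset n U"
  shows "mingens n (mspan U :: 'k::field mpoly set) = mon ` mins U"
proof -
  have mU: "mins U \<subseteq> exps n" using U by (auto simp: mins_def upset_def)
  have monom: "\<exists>T\<subseteq>exps n. S = mon ` T" if "S \<subseteq> monomials n" for S :: "'k mpoly set"
    using that by (intro exI[of _ "{t \<in> exps n. mon t \<in> S}"]) (auto simp: monomials_def exps_def)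
  have "minimal_monomial_gens n (mspan U) (mon ` mins U :: 'k mpoly set)"
    unfolding minimal_monomial_gens_def
  proof (intro conjI allI impI)
    show "(mon ` mins U :: 'k mpoly set) \<subseteq> monomials n"
      using mU by (auto simp: monomials_def exps_def)
    show "Idl\<^bsub>poly_ring n\<^esub> (mon ` mins U) = (mspan U :: 'k mpoly set)"
      using U mU by (simp add: genideal_mon up_mins)
    fix S' :: "'k mpoly set" assume S': "S' \<subset> mon ` mins U"
    then obtain T' where T': "T' \<subset> mins U" "S' = mon ` T'" by (metis psubset_eq subset_image_iff)
    then have "T' \<subseteq> exps n" using mU by auto
    then show "Idl\<^bsub>poly_ring n\<^esub> S' \<noteq> mspan U"
      using T' mins_subset_gens[of n T' U] by (auto simp: genideal_mon mspan_eq_iff)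
  qed
  \<comment> \<open>Any monomial generating set contains the minimal monomials, and these already
    generate; a minimal one therefore contains nothing else.\<close>
  moreover have "S = mon ` mins U" if S: "minimal_monomial_gens n (mspan U) S" for S :: "'k mpoly set"
  proof -
    have "S \<subseteq> monomials n" and gen: "Idl\<^bsub>poly_ring n\<^esub> S = mspan U"
      and min: "\<And>S'. S' \<subset> S \<Longrightarrow> Idl\<^bsub>poly_ring n\<^esub> S' \<noteq> mspan U"
      using S by (simp_all add: minimal_monomial_gens_def)
    then obtain T where T: "T \<subseteq> exps n" "S = mon ` T"
      using monom by meson
    then have "mspan (up n T) = (mspan U :: 'k mpoly set)"
      using gen genideal_mon[OF T(1), where 'k='k] T(2) by simp
    then have "up n T = U" by (simp add: mspan_eq_iff)
    then have "mins U \<subseteq> T" using mins_subset_gens T by blast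
    then have "mon ` mins U \<subseteq> S" using T by blast
    moreover have "Idl\<^bsub>poly_ring n\<^esub> (mon ` mins U) = (mspan U :: 'k mpoly set)"
      using U mU by (simp add: genideal_mon up_mins)
    ultimately show ?thesis using min by (metis psubsetI)
  qed
  ultimately show ?thesis unfolding mingens_def by (rule the_equality)
qed

section \<open>Primes generated by variables and their powers\<close>

lemma var_prime_eq:
  assumes "C \<subseteq> {1..n}"
  shows "var_prime n C = (mspan {t \<in> exps n. 1 \<le> wt C t} :: 'k::field mpoly set)"
proof -
  let ?e = "\<lambda>i. Poly_Mapping.single i (1::nat)"
  have fin: "finite C" using assms finite_subset by blast
  have "var_prime n C = (Idl\<^bsub>poly_ring n\<^esub> (mon ` (?e ` C)) :: 'k mpoly set)"
    by (simp add: var_prime_def var_def image_image)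
  also have "\<dots> = mspan (up n (?e ` C))"
    using assms by (intro genideal_mon) (auto simp: exps_def)
  also have "up n (?e ` C) = {t \<in> exps n. 1 \<le> wt C t}"
  proof -
    have "le_exp (?e i) t \<longleftrightarrow> Poly_Mapping.lookup t i \<noteq> 0" for i t
      by (auto simp: le_exp_def lookup_single when_def)
    moreover have "1 \<le> wt C t \<longleftrightarrow> (\<exists>i\<in>C. Poly_Mapping.lookup t i \<noteq> 0)" for t
      using fin by (simp add: wt_def Suc_le_eq flip: neq0_conv)
    ultimately show ?thesis unfolding up_def by auto
  qed
  finally show ?thesis .
qed

lemma ideal_var_prime: "C \<subseteq> {1..n} \<Longrightarrow> ideal (var_prime n C :: 'k::field mpoly set) (poly_ring n)"
  by (simp add: var_prime_eq ideal_mspan upset_wt)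

text \<open>A monomial of degree at least \<open>Suc l\<close> in the variables of \<open>C\<close>
  is divisible by one of them, and splitting it off leaves degree at least \<open>l\<close>. So each
  further factor of the prime raises the degree bound by one.\<close>

lemma var_prime_pow:
  assumes C: "C \<subseteq> {1..n}"
  shows "var_prime n C [^]\<^bsub>ideals_set (poly_ring n)\<^esub> (l::nat)
    = (mspan {t \<in> exps n. l \<le> wt C t} :: 'k::field mpoly set)"
proof (induction l)
  case 0
  then show ?case by (simp add: ideals_set_def carrier_poly_ring)
next
  case (Suc l)
  interpret ring "poly_ring n :: 'k mpoly ring" by (rule ring_poly_ring)
  let ?W = "\<lambda>l. {t \<in> exps n. l \<le> wt C t}"
  let ?M = "\<lambda>l. mspan (?W l) :: 'k mpoly set"
  have fin: "finite C" using C finite_subset by blast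
  have "var_prime n C [^]\<^bsub>ideals_set (poly_ring n)\<^esub> Suc l = ideal_prod (poly_ring n) (?M l) (?M 1)"
    using Suc C by (simp add: ideals_set_def var_prime_eq)
  also have "\<dots> = ?M (Suc l)"
  proof
    show "ideal_prod (poly_ring n) (?M l) (?M 1) \<subseteq> ?M (Suc l)"
    proof
      fix p assume "p \<in> ideal_prod (poly_ring n) (?M l) (?M 1)"
      then show "p \<in> ?M (Suc l)"
      proof induction
        case (prod p q)
        then have "p * q \<in> ?M (Suc l)" by (rule mspan_mult) (auto simp: wt_add)
        then show ?case by simp
      qed (use mspan_add in auto)
    qed
    have J: "ideal (ideal_prod (poly_ring n) (?M l) (?M 1)) (poly_ring n)"
      by (intro ideal_prod_is_ideal ideal_mspan upset_wt)
    show "?M (Suc l) \<subseteq> ideal_prod (poly_ring n) (?M l) (?M 1)"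
    proof (rule mspan_subset_ideal[OF J])
      fix t assume t: "t \<in> ?W (Suc l)"
      then have "wt C t \<noteq> 0" by auto
      then obtain i where i: "i \<in> C" "Poly_Mapping.lookup t i \<noteq> 0"
        unfolding wt_def by (meson sum.neutral)
      define e where "e = Poly_Mapping.single i (1::nat)"
      have "le_exp e t" using i by (auto simp: e_def le_exp_def lookup_single when_def)
      then have te: "t = (t - e) + e" by (rule le_exp_diff)
      have we: "wt C e = 1" using i fin by (simp add: wt_def e_def lookup_single when_def)
      have "t - e \<in> ?W l" using t we exps_diff[of t n e] wt_add[of C "t - e" e] unfolding te[symmetric] by auto
      moreover have "e \<in> ?W 1" using i C we by (auto simp: e_def exps_def)
      ultimately have "mon (t - e) \<otimes>\<^bsub>poly_ring n\<^esub> mon e \<in> ideal_prod (poly_ring n) (?M l) (?M 1)"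
        by (intro ideal_prod.prod) auto
      then show "mon t \<in> ideal_prod (poly_ring n) (?M l) (?M 1)"
        by (simp add: mult_single flip: te)
    qed
  qed
  finally show ?case .
qed

lemma mspan_split:
  assumes "p \<in> mspan (U \<union> V)"
  obtains q r where "p = q + r" "q \<in> mspan U" "r \<in> mspan V"
proof
  let ?s = "\<lambda>t. Poly_Mapping.single t (Poly_Mapping.lookup p t)"
  let ?K = "Poly_Mapping.keys p"
  show "p = (\<Sum>t\<in>?K \<inter> U. ?s t) + (\<Sum>t\<in>?K - U. ?s t)"
    by (rule trans[OF mpoly_sum_monomials sum.Int_Diff]) simp
  show "(\<Sum>t\<in>?K \<inter> U. ?s t) \<in> mspan U" by (auto intro!: mspan_sum single_mem_mspan)
  show "(\<Sum>t\<in>?K - U. ?s t) \<in> mspan V"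
    using assms by (intro mspan_sum single_mem_mspan) (auto simp: mspan_def)
qed

text \<open>Modulo the ideal, \<open>p\<close> and \<open>q\<close> may be replaced by their parts
  \<open>p0\<close> and \<open>q0\<close> free of the variables of \<open>C\<close>. The product
  \<open>p0 * q0\<close> is again free of them, so it lies in the ideal only if it is 0; and there
  are no zero divisors.\<close>

lemma primeideal_var_prime:
  assumes C: "C \<subseteq> {1..n}"
  shows "primeideal (var_prime n C :: 'k::field mpoly set) (poly_ring n)"
proof (rule primeidealI)
  show "ideal (var_prime n C :: 'k mpoly set) (poly_ring n)" using C by (rule ideal_var_prime)
  show "cring (poly_ring n :: 'k mpoly ring)" by (rule cring_poly_ring)
  let ?P = "{t \<in> exps n. 1 \<le> wt C t}"
  let ?N = "{t \<in> exps n. wt C t = 0}"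
  have "0 \<in> exps n - ?P" by (simp add: wt_def)
  then show "carrier (poly_ring n) \<noteq> (var_prime n C :: 'k mpoly set)"
    unfolding var_prime_eq[OF C] carrier_poly_ring mspan_eq_iff by blast
  fix p q :: "'k mpoly"
  assume p: "p \<in> carrier (poly_ring n)" and q: "q \<in> carrier (poly_ring n)"
    and pq: "p \<otimes>\<^bsub>poly_ring n\<^esub> q \<in> var_prime n C"
  have NP: "?N \<union> ?P = exps n" by auto
  obtain p0 p1 where p': "p = p0 + p1" "p0 \<in> mspan ?N" "p1 \<in> mspan ?P"
    using mspan_split[of p ?N ?P] p unfolding carrier_poly_ring NP by blast
  obtain q0 q1 where q': "q = q0 + q1" "q0 \<in> mspan ?N" "q1 \<in> mspan ?P"
    using mspan_split[of q ?N ?P] q unfolding carrier_poly_ring NP by blast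
  have N: "p0 * q0 \<in> mspan ?N" using p'(2) q'(2) by (rule mspan_mult) (auto simp: wt_add)
  have "p0 * q0 = p * q - (p * q1 + p1 * q0)" unfolding p'(1) q'(1) by (simp add: algebra_simps)
  moreover have "p * q \<in> mspan ?P" using pq C by (simp add: var_prime_eq)
  moreover have "p * q1 \<in> mspan ?P"
    using p q'(3) unfolding carrier_poly_ring by (rule mspan_mult) (auto simp: wt_add)
  moreover have "p1 * q0 \<in> mspan ?P"
    using p'(3) q'(2) by (rule mspan_mult) (auto simp: wt_add)
  ultimately have "p0 * q0 \<in> mspan ?P" by (simp add: mspan_add mspan_diff)
  then have "Poly_Mapping.keys (p0 * q0) \<subseteq> ?P \<inter> ?N" using N by (simp add: mspan_def)
  also have "?P \<inter> ?N = {}" by auto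
  finally have "p0 * q0 = 0" by simp
  then have "p0 = 0 \<or> q0 = 0" by simp
  then show "p \<in> var_prime n C \<or> q \<in> var_prime n C"
    unfolding var_prime_eq[OF C] p'(1) q'(1) using p'(3) q'(3) by auto
qed

section \<open>Symbolic powers of intersections of variable primes\<close>

text \<open>The exponent vectors of the monomials in the \<open>l\<close>-th symbolic power of the intersection of the
  primes \<open>var_prime n C\<close> with \<open>C \<in> \<C>\<close>; for a Stanley--Reisner ideal, \<open>\<C>\<close> consists of the complements of the facets.\<close>

definition cov :: "nat \<Rightarrow> nat set set \<Rightarrow> nat \<Rightarrow> (nat \<Rightarrow>\<^sub>0 nat) set" where
  "cov n \<C> l = {t \<in> exps n. \<forall>C\<in>\<C>. l \<le> wt C t}"

definition ind :: "nat set \<Rightarrow> nat \<Rightarrow>\<^sub>0 nat" where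
  "ind A = (\<Sum>i\<in>A. Poly_Mapping.single i 1)"

definition sqf :: "(nat \<Rightarrow>\<^sub>0 nat) \<Rightarrow> bool" where
  "sqf t \<longleftrightarrow> (\<forall>i. Poly_Mapping.lookup t i \<le> 1)"

text \<open>The factorization asked for in \<open>cond_T\<close>, written additively for exponents;
  the bound of the \<open>c i\<close> by the height is recovered in
  \<open>cond_T_iff\<close>.\<close>

definition chain_decomp :: "nat \<Rightarrow> nat set set \<Rightarrow> nat \<Rightarrow> (nat \<Rightarrow>\<^sub>0 nat) \<Rightarrow> bool" where
  "chain_decomp n \<C> l t \<longleftrightarrow> (\<exists>s (u :: nat \<Rightarrow> nat \<Rightarrow>\<^sub>0 nat) (c :: nat \<Rightarrow> nat).
     t = (\<Sum>i=1..s. u i) \<and>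
     (\<forall>i\<in>{1..s}. 1 \<le> c i \<and> sqf (u i) \<and> u i \<in> mins (cov n \<C> (c i))) \<and>
     (\<Sum>i=1..s. c i) = l \<and>
     (\<forall>i. 1 \<le> i \<and> i < s \<longrightarrow> Poly_Mapping.keys (u (Suc i)) \<subseteq> Poly_Mapping.keys (u i)))"

text \<open>The properties of the family of facet complements that the algebra uses; being an
  antichain, it consists of exactly the index sets of the associated primes.\<close>

definition clutter :: "nat \<Rightarrow> nat set set \<Rightarrow> bool" where
  "clutter n \<C> \<longleftrightarrow> \<C> \<noteq> {} \<and> \<C> \<subseteq> Pow {1..n} \<and> (\<forall>C\<in>\<C>. \<forall>D\<in>\<C>. C \<subseteq> D \<longrightarrow> C = D)"

section \<open>Indicator vectors and supports\<close>

lemma upset_cov: "upset n (cov n \<C> l)"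
  unfolding upset_def cov_def using wt_mono order_trans by blast

lemma lookup_ind: "finite A \<Longrightarrow> Poly_Mapping.lookup (ind A) i = (if i \<in> A then 1 else 0)"
  by (simp add: ind_def lookup_sum lookup_single when_def)

lemma keys_ind: "finite A \<Longrightarrow> Poly_Mapping.keys (ind A) = A"
  by (auto simp: in_keys_iff lookup_ind split: if_splits)

lemma wt_ind: "finite A \<Longrightarrow> finite C \<Longrightarrow> wt C (ind A) = card (C \<inter> A)"
  by (simp add: wt_def lookup_ind sum.If_cases)

lemma ind_exps: "A \<subseteq> {1..n} \<Longrightarrow> ind A \<in> exps n"
  using keys_ind[of A] finite_subset[of A "{1..n}"] by (auto simp: exps_def)

lemma ind_keys:
  assumes "sqf t"
  shows "t = ind (Poly_Mapping.keys t)"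
proof (rule poly_mapping_eqI)
  fix i
  have "Poly_Mapping.lookup t i \<le> 1" using assms by (simp add: sqf_def)
  then show "Poly_Mapping.lookup t i = Poly_Mapping.lookup (ind (Poly_Mapping.keys t)) i"
    by (auto simp: lookup_ind in_keys_iff)
qed

lemma sqf_ind: "finite A \<Longrightarrow> sqf (ind A)"
  by (simp add: sqf_def lookup_ind)

lemma sqf_mono: "le_exp s t \<Longrightarrow> sqf t \<Longrightarrow> sqf s"
  unfolding sqf_def le_exp_def using order_trans by blast

lemma supp_mon:
  assumes "t \<in> exps n"
  shows "supp n (mon t :: 'k::field mpoly) = Poly_Mapping.keys t"
proof -
  have "(var i :: 'k mpoly) divides\<^bsub>poly_ring n\<^esub> mon t \<longleftrightarrow> i \<in> Poly_Mapping.keys t" for i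
  proof
    assume "(var i :: 'k mpoly) divides\<^bsub>poly_ring n\<^esub> mon t"
    then obtain c :: "'k mpoly" where "mon t = var i * c" by (auto simp: factor_def)
    then have "t \<in> Poly_Mapping.keys (var i * c)" by (metis keys_single singletonI zero_neq_one)
    then obtain b where "t = Poly_Mapping.single i 1 + b"
      using keys_mult[of "var i" c] by (auto simp: var_def)
    then show "i \<in> Poly_Mapping.keys t" by (simp add: keys_exp_add)
  next
    assume i: "i \<in> Poly_Mapping.keys t"
    have "le_exp (Poly_Mapping.single i 1) t"
      using i by (auto simp: le_exp_def lookup_single when_def in_keys_iff)
    from le_exp_diff[OF this]
    have "(mon t :: 'k mpoly) = var i \<otimes>\<^bsub>poly_ring n\<^esub> mon (t - Poly_Mapping.single i 1)"
      by (simp add: var_def mult_single add.commute)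
    then show "(var i :: 'k mpoly) divides\<^bsub>poly_ring n\<^esub> mon t"
      using exps_diff[OF assms] by (intro dividesI) (auto simp: carrier_poly_ring)
  qed
  then show ?thesis using assms by (auto simp: supp_def exps_def)
qed

lemma prod_mon: "(\<Prod>i\<in>A. mon (u i)) = (mon (\<Sum>i\<in>A. u i) :: 'k::field mpoly)"
  by (induction A rule: infinite_finite_induct) (auto simp: mult_single)

section \<open>Primes over an intersection, and height\<close>

text \<open>Otherwise choose in each \<open>J C\<close> an element outside \<open>P\<close>: the
  product lies in the intersection but, \<open>P\<close> being prime, not in \<open>P\<close>. For
  empty \<open>D\<close> the product is 1 and the intersection is the carrier.\<close>

lemma prime_contains_INT:
  assumes P: "primeideal P (poly_ring n :: 'k::field mpoly ring)" and D: "finite D"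
    and J: "\<And>C. C \<in> D \<Longrightarrow> ideal (J C) (poly_ring n)"
    and sub: "carrier (poly_ring n) \<inter> (\<Inter>C\<in>D. J C) \<subseteq> P"
  shows "\<exists>C\<in>D. J C \<subseteq> P"
proof (rule ccontr)
  interpret cring "poly_ring n :: 'k mpoly ring" by (rule cring_poly_ring)
  interpret P: primeideal P "poly_ring n" by (rule P)
  assume "\<not> ?thesis"
  then have "\<forall>C\<in>D. \<exists>x. x \<in> J C \<and> x \<notin> P" by blast
  from bchoice[OF this] obtain a where a: "\<And>C. C \<in> D \<Longrightarrow> a C \<in> J C \<and> a C \<notin> P" by blast
  have "1 \<notin> P" using P.one_imp_carrier P.I_notcarr by auto
  have "E \<subseteq> D \<Longrightarrow> prod a E \<in> carrier (poly_ring n) - P \<and> (\<forall>C\<in>E. prod a E \<in> J C)" if "finite E" for E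
    using that
  proof induction
    case empty
    then show ?case using \<open>1 \<notin> P\<close> one_closed by simp
  next
    case (insert C E)
    have C: "a C \<in> J C" "a C \<notin> P" "a C \<in> carrier (poly_ring n)"
      using a insert.prems ideal.Icarr[OF J] by auto
    have E: "prod a E \<in> carrier (poly_ring n)" "prod a E \<notin> P" "\<forall>C\<in>E. prod a E \<in> J C"
      using insert by auto
    have "a C * prod a E \<notin> P" using P.I_prime[OF C(3) E(1)] C E by auto
    moreover have "a C * prod a E \<in> carrier (poly_ring n)" using m_closed[OF C(3) E(1)] by simp
    moreover have "a C * prod a E \<in> J B" if "B \<in> insert C E" for B
      using that ideal.I_r_closed[OF J, of C "a C" "prod a E"]
        ideal.I_l_closed[OF J, of B "prod a E" "a C"] C E insert.prems by auto
    ultimately show ?case using insert by auto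
  qed
  from this[OF D] show False using sub by auto
qed

lemma var_prime_mono: "C \<subseteq> D \<Longrightarrow> var_prime n C \<subseteq> (var_prime n D :: 'k::field mpoly set)"
  unfolding var_prime_def genideal_def by (rule Inter_anti_mono) (auto simp: image_subset_iff)

lemma var_prime_strict_mono:
  assumes "C \<subset> D" "D \<subseteq> {1..n}"
  shows "var_prime n C \<subset> (var_prime n D :: 'k::field mpoly set)"
proof -
  obtain i where i: "i \<in> D" "i \<notin> C" using assms by auto
  have fin: "finite D" using assms finite_subset by blast
  then have "finite C" using assms finite_subset by blast
  with fin have "wt C (ind {i}) = 0" "wt D (ind {i}) = 1" using i by (auto simp: wt_ind)
  moreover have "ind {i} \<in> exps n" using i assms by (intro ind_exps) auto
  ultimately have "(mon (ind {i}) :: 'k mpoly) \<in> var_prime n D - var_prime n C"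
    using assms by (subst (1 2) var_prime_eq) auto
  then show ?thesis using var_prime_mono[of C D n] assms by blast
qed

text \<open>Adjoining the variables of \<open>C\<close> one at a time gives a strict chain of primes
  with \<open>card C\<close> steps.\<close>

lemma prime_height_ge:
  assumes P: "primeideal P (poly_ring n :: 'k::field mpoly ring)" and C: "C \<subseteq> {1..n}"
    and sub: "var_prime n C \<subseteq> P"
  shows "enat (card C) \<le> prime_height (poly_ring n) P"
proof -
  obtain xs where xs: "set xs = C" "distinct xs" "length xs = card C"
    using finite_distinct_list[of C] finite_subset[OF C] distinct_card by fastforce
  \<comment> \<open>The top member is \<open>P\<close> in place of the prime of all of
    \<open>C\<close>, so that the chain ends at \<open>P\<close>; it stays strict because
    \<open>P\<close> contains that prime.\<close>
  define Q where "Q i = (if i = card C then P else var_prime n (set (take i xs)))" for i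
  have tk: "set (take i xs) \<subseteq> {1..n}" for i using set_take_subset[of i xs] xs C by auto
  have "primeideal (Q i) (poly_ring n)" for i
    using P primeideal_var_prime[OF tk] unfolding Q_def by (cases "i = card C") simp_all
  moreover have "Q i \<subset> Q (Suc i)" if i: "i < card C" for i
  proof -
    have "set (take (Suc i) xs) = insert (xs ! i) (set (take i xs))"
      using i xs by (simp add: take_Suc_conv_app_nth)
    moreover have "xs ! i \<notin> set (take i xs)"
      using i xs(2,3) by (metis distinct_take take_Suc_conv_app_nth not_distinct_conv_prefix append_Nil2)
    ultimately have "set (take i xs) \<subset> set (take (Suc i) xs)" by auto
    then have "var_prime n (set (take i xs)) \<subset> (var_prime n (set (take (Suc i) xs)) :: 'k mpoly set)"
      using tk by (rule var_prime_strict_mono)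
    moreover have "var_prime n (set (take (Suc i) xs)) \<subseteq> Q (Suc i)"
      using sub xs by (auto simp: Q_def)
    ultimately show ?thesis using i by (auto simp: Q_def)
  qed
  moreover have "Q (card C) = P" by (simp add: Q_def)
  ultimately show ?thesis unfolding prime_height_def by (intro Sup_upper) blast
qed

text \<open>A prime over the intersection contains one of the variable primes, whose chain bounds
  its height from below.\<close>

lemma height_INT_ge:
  assumes fin: "finite \<C>" and sub: "\<C> \<subseteq> Pow {1..n}" and c: "\<And>C. C \<in> \<C> \<Longrightarrow> c \<le> card C"
  shows "enat c \<le> height (poly_ring n) (\<Inter>C\<in>\<C>. var_prime n C :: 'k::field mpoly set)"
  unfolding height_def
proof (rule Inf_greatest, clarify)
  fix P :: "'k mpoly set"
  assume P: "primeideal P (poly_ring n)" "(\<Inter>C\<in>\<C>. var_prime n C) \<subseteq> P"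
  have "\<exists>C\<in>\<C>. var_prime n C \<subseteq> P"
  proof (rule prime_contains_INT[OF P(1) fin])
    show "ideal (var_prime n C :: 'k mpoly set) (poly_ring n)" if "C \<in> \<C>" for C
      using that sub ideal_var_prime by blast
  qed (use P in blast)
  then obtain C where C: "C \<in> \<C>" "var_prime n C \<subseteq> P" by blast
  have "enat c \<le> enat (card C)" using c C by simp
  also have "\<dots> \<le> prime_height (poly_ring n) P"
    using C sub by (intro prime_height_ge[OF P(1)]) auto
  finally show "enat c \<le> prime_height (poly_ring n) P" .
qed

section \<open>Associated primes and symbolic powers\<close>

lemma quot_mult_eq_zero_iff:
  assumes J: "ideal J (poly_ring n :: 'k::field mpoly ring)"
    and r: "r \<in> carrier (poly_ring n)" and w: "w \<in> carrier (poly_ring n)"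
  shows "(J +>\<^bsub>poly_ring n\<^esub> r) \<otimes>\<^bsub>poly_ring n Quot J\<^esub> (J +>\<^bsub>poly_ring n\<^esub> w)
    = \<zero>\<^bsub>poly_ring n Quot J\<^esub> \<longleftrightarrow> r * w \<in> J"
proof -
  interpret ideal J "poly_ring n" by (rule J)
  have rw: "r * w \<in> carrier (poly_ring n)" using m_closed[OF r w] by simp
  have "(J +>\<^bsub>poly_ring n\<^esub> r) \<otimes>\<^bsub>poly_ring n Quot J\<^esub> (J +>\<^bsub>poly_ring n\<^esub> w) = J +>\<^bsub>poly_ring n\<^esub> (r * w)"
    using rcoset_mult_add[OF r w] by (simp add: FactRing_def)
  moreover have "J +>\<^bsub>poly_ring n\<^esub> (r * w) = J \<longleftrightarrow> r * w \<in> J"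
    using rcos_const_imp_mem[OF rw] a_rcos_zero[OF J] by blast
  ultimately show ?thesis by (simp add: FactRing_def)
qed

text \<open>The annihilator of a coset is the intersection of those primes of the family that avoid
  its representative, so a prime annihilator is one of them.\<close>

lemma Ass_INT_var_prime:
  assumes cl: "clutter n \<C>"
  shows "Ass (poly_ring n) (\<Inter>C\<in>\<C>. var_prime n C) = (var_prime n ` \<C> :: 'k::field mpoly set set)"
proof -
  let ?R = "poly_ring n :: 'k mpoly ring"
  let ?P = "\<lambda>C. var_prime n C :: 'k mpoly set"
  let ?I = "\<Inter>C\<in>\<C>. ?P C"
  have sub: "\<C> \<subseteq> Pow {1..n}" and ne: "\<C> \<noteq> {}"
    and anti: "\<And>C D. C \<in> \<C> \<Longrightarrow> D \<in> \<C> \<Longrightarrow> C \<subseteq> D \<Longrightarrow> C = D"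
    using cl unfolding clutter_def by blast+
  have fin: "finite \<C>" using sub finite_subset by blast
  interpret cring ?R by (rule cring_poly_ring)
  have pr: "primeideal (?P C) ?R" if "C \<in> \<C>" for C using that sub primeideal_var_prime by blast
  have id: "ideal (?P C) ?R" if "C \<in> \<C>" for C using pr[OF that] by (rule primeideal.axioms)
  have I: "ideal ?I ?R"
    using i_Intersect[of "?P ` \<C>"] id ne by auto
  have mem: "r * w \<in> ?P C \<longleftrightarrow> r \<in> ?P C \<or> w \<in> ?P C"
    if "C \<in> \<C>" "r \<in> carrier ?R" "w \<in> carrier ?R" for C r w
    using primeideal.I_prime[OF pr[OF that(1)] that(2,3)] ideal.I_l_closed[OF id[OF that(1)] _ that(2), of w]
      ideal.I_r_closed[OF id[OF that(1)] _ that(3), of r] by auto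
  show ?thesis
  proof
    show "Ass ?R ?I \<subseteq> ?P ` \<C>"
    proof
      fix P assume "P \<in> Ass ?R ?I"
      then obtain z where P: "primeideal P ?R" and z: "z \<in> carrier (?R Quot ?I)"
        and Pz: "P = {r \<in> carrier ?R. (?I +>\<^bsub>?R\<^esub> r) \<otimes>\<^bsub>?R Quot ?I\<^esub> z = \<zero>\<^bsub>?R Quot ?I\<^esub>}"
        unfolding Ass_def by blast
      from z obtain w where w: "w \<in> carrier ?R" "z = ?I +>\<^bsub>?R\<^esub> w"
        by (auto simp: FactRing_def A_RCOSETS_def')
      define D where "D = {C \<in> \<C>. w \<notin> ?P C}"
      have PD: "P = carrier ?R \<inter> (\<Inter>C\<in>D. ?P C)"
        unfolding Pz w(2) D_def using quot_mult_eq_zero_iff[OF I _ w(1)] mem[OF _ _ w(1)] by auto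
      have "\<exists>C\<in>D. ?P C \<subseteq> P"
        using PD fin id by (intro prime_contains_INT[OF P]) (auto simp: D_def)
      then obtain C where C: "C \<in> D" "?P C \<subseteq> P" by blast
      then have "P = ?P C" using PD by blast
      then show "P \<in> ?P ` \<C>" using C by (auto simp: D_def)
    qed
    show "?P ` \<C> \<subseteq> Ass ?R ?I"
    proof clarify
      fix C0 assume C0: "C0 \<in> \<C>"
      \<comment> \<open>The product of the variables outside \<open>C0\<close> avoids the prime of
        \<open>C0\<close> and lies in every other one, since no other member of the antichain is
        contained in \<open>C0\<close>.\<close>
      define w :: "'k mpoly" where "w = mon (ind ({1..n} - C0))"
      have ie: "ind ({1..n} - C0) \<in> exps n" by (rule ind_exps) auto
      then have w: "w \<in> carrier ?R" by (simp add: w_def carrier_poly_ring)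
      have wP: "w \<in> ?P C \<longleftrightarrow> C \<noteq> C0" if C: "C \<in> \<C>" for C
      proof -
        have CN: "C \<subseteq> {1..n}" "finite C" using C sub finite_subset[of C "{1..n}"] by auto
        then have "w \<in> ?P C \<longleftrightarrow> 1 \<le> card (C \<inter> ({1..n} - C0))"
          using ie by (simp add: w_def var_prime_eq wt_ind)
        also have "\<dots> \<longleftrightarrow> C \<inter> ({1..n} - C0) \<noteq> {}" using CN by (simp add: Suc_le_eq card_gt_0_iff)
        also have "\<dots> \<longleftrightarrow> \<not> C \<subseteq> C0" using CN by auto
        finally show ?thesis using anti[OF C C0] by blast
      qed
      have "?P C0 = {r \<in> carrier ?R. r * w \<in> ?I}"
        using mem[OF _ _ w] wP C0 ideal.Icarr[OF id[OF C0]] by auto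
      then have "?P C0 = {r \<in> carrier ?R. (?I +>\<^bsub>?R\<^esub> r) \<otimes>\<^bsub>?R Quot ?I\<^esub> (?I +>\<^bsub>?R\<^esub> w) = \<zero>\<^bsub>?R Quot ?I\<^esub>}"
        using quot_mult_eq_zero_iff[OF I _ w] by auto
      moreover have "?I +>\<^bsub>?R\<^esub> w \<in> carrier (?R Quot ?I)"
        using w by (auto simp: FactRing_def A_RCOSETS_def')
      ultimately show "?P C0 \<in> Ass ?R ?I" using pr[OF C0] unfolding Ass_def by blast
    qed
  qed
qed

lemma symb_pow_INT_var_prime:
  assumes cl: "clutter n \<C>"
  shows "symb_pow (poly_ring n) (\<Inter>C\<in>\<C>. var_prime n C) l = (mspan (cov n \<C> l) :: 'k::field mpoly set)"
proof -
  have "symb_pow (poly_ring n) (\<Inter>C\<in>\<C>. var_prime n C) l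
    = (mspan (exps n) \<inter> (\<Inter>C\<in>\<C>. mspan {t \<in> exps n. l \<le> wt C t}) :: 'k mpoly set)"
    unfolding symb_pow_def Ass_INT_var_prime[OF cl] carrier_poly_ring image_image
    using cl by (intro arg_cong2[where f = "(\<inter>)"] INF_cong var_prime_pow) (auto simp: clutter_def)
  also have "\<dots> = mspan (cov n \<C> l)"
    by (auto simp: mspan_def cov_def)
  finally show ?thesis .
qed

lemma INT_var_prime:
  assumes cl: "clutter n \<C>"
  shows "(\<Inter>C\<in>\<C>. var_prime n C) = (mspan (cov n \<C> 1) :: 'k::field mpoly set)"
proof -
  have "(\<Inter>C\<in>\<C>. var_prime n C) = (\<Inter>C\<in>\<C>. mspan {t \<in> exps n. 1 \<le> wt C t} :: 'k mpoly set)"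
    using cl by (intro INF_cong var_prime_eq) (auto simp: clutter_def)
  then show ?thesis using cl by (auto simp: mspan_def cov_def clutter_def)
qed

section \<open>Translation into weightings\<close>

lemma cond_T_iff:
  fixes I :: "'k::field mpoly set"
  assumes cl: "clutter n \<C>"
    and I: "I = (\<Inter>C\<in>\<C>. var_prime n C)"
  shows "cond_T n I l \<longleftrightarrow> (\<forall>t\<in>mins (cov n \<C> l). chain_decomp n \<C> l t)"
proof -
  let ?R = "poly_ring n :: 'k mpoly ring"
  have fam: "finite \<C>" "\<C> \<subseteq> Pow {1..n}"
    using cl finite_subset[of \<C> "Pow {1..n}"] by (auto simp: clutter_def)
  have mg: "mingens n (symb_pow ?R I k) = mon ` mins (cov n \<C> k)" for k
    unfolding I symb_pow_INT_var_prime[OF cl] by (rule mingens_mspan[OF upset_cov])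
  have ex: "t \<in> exps n" if "t \<in> mins (cov n \<C> k)" for t k
    using that by (simp add: mins_def cov_def)
  \<comment> \<open>A squarefree vector has weight at most \<open>card C\<close> on
    \<open>C\<close>, so \<open>k\<close> is at most every \<open>card C\<close> and thus at most
    the height.\<close>
  have ht: "enat k \<le> height ?R I" if u: "sqf u" "u \<in> mins (cov n \<C> k)" for u k
    unfolding I
  proof (rule height_INT_ge[OF fam(1,2)])
    fix C assume C: "C \<in> \<C>"
    have "k \<le> wt C u" using u C by (simp add: mins_def cov_def)
    also have "\<dots> \<le> (\<Sum>i\<in>C. 1)" unfolding wt_def using u(1) by (intro sum_mono) (simp add: sqf_def)
    finally show "k \<le> card C" by simp
  qed
  have sq: "(mon u :: 'k mpoly) \<in> sqfree_monomials n \<longleftrightarrow> u \<in> exps n \<and> sqf u" for u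
    using inj_mon[THEN injD] by (auto simp: sqfree_monomials_def exps_def sqf_def)
  have "(\<exists>s (f :: nat \<Rightarrow> 'k mpoly) (c :: nat \<Rightarrow> nat).
        mon t = (\<Prod>i=1..s. f i) \<and>
        (\<forall>i\<in>{1..s}. 1 \<le> c i \<and> enat (c i) \<le> height ?R I \<and>
          f i \<in> sqfree_monomials n \<and> f i \<in> mingens n (symb_pow ?R I (c i))) \<and>
        (\<Sum>i=1..s. c i) = l \<and>
        (\<forall>i. 1 \<le> i \<and> i < s \<longrightarrow> supp n (f (Suc i)) \<subseteq> supp n (f i)))
      \<longleftrightarrow> chain_decomp n \<C> l t" (is "?L \<longleftrightarrow> ?D") for t
  proof
    assume ?L
    then obtain s and f :: "nat \<Rightarrow> 'k mpoly" and c :: "nat \<Rightarrow> nat" where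
      t: "mon t = (\<Prod>i=1..s. f i)"
      and f: "\<forall>i\<in>{1..s}. 1 \<le> c i \<and> f i \<in> sqfree_monomials n \<and> f i \<in> mon ` mins (cov n \<C> (c i))"
      and c: "(\<Sum>i=1..s. c i) = l"
      and ch: "\<forall>i. 1 \<le> i \<and> i < s \<longrightarrow> supp n (f (Suc i)) \<subseteq> supp n (f i)"
      unfolding mg by blast
    have "\<forall>i\<in>{1..s}. \<exists>u. u \<in> mins (cov n \<C> (c i)) \<and> f i = mon u" using f by blast
    then obtain u where u: "\<And>i. i \<in> {1..s} \<Longrightarrow> u i \<in> mins (cov n \<C> (c i)) \<and> f i = mon (u i)"
      by metis
    have "mon t = (mon (\<Sum>i=1..s. u i) :: 'k mpoly)" unfolding t prod_mon[symmetric] using u by simp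
    then have "t = (\<Sum>i=1..s. u i)" by (rule injD[OF inj_mon])
    moreover have "\<forall>i\<in>{1..s}. 1 \<le> c i \<and> sqf (u i) \<and> u i \<in> mins (cov n \<C> (c i))"
      using f u sq by metis
    moreover have "supp n (f i) = Poly_Mapping.keys (u i)" if "i \<in> {1..s}" for i
      using u[OF that] ex supp_mon by metis
    then have "\<forall>i. 1 \<le> i \<and> i < s \<longrightarrow> Poly_Mapping.keys (u (Suc i)) \<subseteq> Poly_Mapping.keys (u i)"
      using ch by simp
    ultimately show ?D using c unfolding chain_decomp_def by blast
  next
    assume ?D
    then obtain s u c where t: "t = (\<Sum>i=1..s. u i)"
      and u: "\<forall>i\<in>{1..s}. 1 \<le> c i \<and> sqf (u i) \<and> u i \<in> mins (cov n \<C> (c i))"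
      and c: "(\<Sum>i=1..s. c i) = l"
      and ch: "\<forall>i. 1 \<le> i \<and> i < s \<longrightarrow> Poly_Mapping.keys (u (Suc i)) \<subseteq> Poly_Mapping.keys (u i)"
      unfolding chain_decomp_def by blast
    have "supp n (mon (u i) :: 'k mpoly) = Poly_Mapping.keys (u i)" if "i \<in> {1..s}" for i
      using u that ex supp_mon by blast
    then have "\<forall>i. 1 \<le> i \<and> i < s \<longrightarrow> supp n (mon (u (Suc i)) :: 'k mpoly) \<subseteq> supp n (mon (u i) :: 'k mpoly)"
      using ch by simp
    moreover have "\<forall>i\<in>{1..s}. 1 \<le> c i \<and> enat (c i) \<le> height ?R I \<and>
          mon (u i) \<in> (sqfree_monomials n :: 'k mpoly set) \<and> mon (u i) \<in> mingens n (symb_pow ?R I (c i))"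
      using u ht ex unfolding mg sq by blast
    moreover have "mon t = (\<Prod>i=1..s. mon (u i) :: 'k mpoly)" using t by (simp add: prod_mon)
    ultimately show ?L using c by blast
  qed
  then show ?thesis unfolding cond_T_def mg by simp
qed

text \<open>Divisors of squarefree monomials are squarefree, so minimality among the squarefree
  exponents is the same as minimality in \<open>cov n \<C> 2\<close>.\<close>

lemma SF2_mingens:
  fixes I :: "'k::field mpoly set"
  assumes cl: "clutter n \<C>"
    and I: "I = (\<Inter>C\<in>\<C>. var_prime n C)"
  shows "mingens n (SF2 n I) = mon ` {t \<in> mins (cov n \<C> 2). sqf t}"
proof -
  let ?S = "{t \<in> cov n \<C> 2. sqf t}"
  have S: "?S \<subseteq> exps n" by (auto simp: cov_def)
  have "sqfree_monomials n \<inter> symb_pow (poly_ring n) I 2 = (mon ` ?S :: 'k mpoly set)"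
    unfolding I symb_pow_INT_var_prime[OF cl]
    by (auto simp: sqfree_monomials_def sqf_def cov_def exps_def)
  then have "SF2 n I = mspan (up n ?S)" using genideal_mon[OF S] by (simp add: SF2_def)
  then have "mingens n (SF2 n I) = mon ` mins (up n ?S)" by (simp add: mingens_mspan upset_up)
  also have "mins (up n ?S) = {t \<in> mins (cov n \<C> 2). sqf t}"
  proof (intro equalityI subsetI)
    fix t assume t: "t \<in> mins (up n ?S)"
    then obtain s where s: "s \<in> ?S" "le_exp s t" by (auto simp: mins_def up_def)
    moreover have SS: "?S \<subseteq> up n ?S" using S le_exp_refl by (auto simp: up_def)
    ultimately have "t \<in> ?S" using t by (auto simp: mins_def)
    moreover have "r = t" if "r \<in> cov n \<C> 2" "le_exp r t" for r
    proof -
      have "r \<in> ?S" using that \<open>t \<in> ?S\<close> sqf_mono by auto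
      then show ?thesis using SS t that by (auto simp: mins_def)
    qed
    ultimately show "t \<in> {t \<in> mins (cov n \<C> 2). sqf t}" by (simp add: mins_def)
  next
    fix t assume t: "t \<in> {t \<in> mins (cov n \<C> 2). sqf t}"
    have "up n ?S \<subseteq> cov n \<C> 2" using upset_cov[of n \<C> 2] by (auto simp: up_def upset_def)
    moreover have "t \<in> up n ?S" using t S le_exp_refl by (auto simp: up_def mins_def)
    ultimately show "t \<in> mins (up n ?S)" using t by (auto simp: mins_def)
  qed
  finally show ?thesis .
qed

lemma sq_mon: "(mon t :: 'k::field mpoly) ^ 2 = mon (t + t)"
  by (simp add: power2_eq_square mult_single)

section \<open>Matroids\<close>

text \<open>Exchanging an element of \<open>A - B\<close> for one of \<open>B - A\<close> keeps the
  size of \<open>A\<close> and shrinks \<open>A - B\<close>, until \<open>A\<close> is contained in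
  \<open>B\<close>.\<close>

lemma matroid_bases_card_le:
  assumes M: "matroid_bases E \<B>" and "A \<in> \<B>" "B \<in> \<B>"
  shows "card A \<le> card B"
  using assms(2)
proof (induction "card (A - B)" arbitrary: A rule: less_induct)
  case less
  have sub: "finite S" if "S \<in> \<B>" for S
    using M that finite_subset[of S E] by (auto simp: matroid_bases_def)
  show ?case
  proof (cases "A \<subseteq> B")
    case True
    then show ?thesis using card_mono sub assms(3) by blast
  next
    case False
    then obtain a where a: "a \<in> A - B" by blast
    then obtain b where b: "b \<in> B - A" "insert b (A - {a}) \<in> \<B>"
      using M less.prems assms(3) unfolding matroid_bases_def by meson
    have "insert b (A - {a}) - B = (A - B) - {a}" using a b by auto
    then have "card (insert b (A - {a}) - B) < card (A - B)"
      using a sub[OF less.prems] by (metis DiffI DiffE card_Diff1_less finite_Diff)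
    then have "card (insert b (A - {a})) \<le> card B" using less.hyps b(2) by blast
    moreover have "card (insert b (A - {a})) = card A"
      using a b sub[OF less.prems] by (metis DiffE card.remove card_insert_disjoint finite_Diff)
    ultimately show ?thesis by simp
  qed
qed

text \<open>The exchange behind the greedy algorithm. \<open>G\<close> is moved towards
  \<open>F\<close> until \<open>G - F\<close> lies in \<open>A\<close>; an exchange in
  \<open>F\<close> against this \<open>G\<close> then brings in an element of
  \<open>A\<close>.\<close>

lemma matroid_bases_exchange_into:
  assumes M: "matroid_bases E \<B>" and F: "F \<in> \<B>" and "G \<in> \<B>" "card (F \<inter> A) < card (G \<inter> A)"
  shows "\<exists>e\<in>F - A. \<exists>f\<in>A - F. insert f (F - {e}) \<in> \<B>"
  using assms(3,4)
proof (induction "card (G - F)" arbitrary: G rule: less_induct)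
  case less
  have fin: "finite S" if "S \<in> \<B>" for S
    using M that finite_subset[of S E] by (auto simp: matroid_bases_def)
  have ex: "\<exists>b\<in>T - S. insert b (S - {a}) \<in> \<B>" if "S \<in> \<B>" "T \<in> \<B>" "a \<in> S - T" for S T a
    using M that unfolding matroid_bases_def by blast
  note finG = fin[OF less.prems(1)]
  note finF = fin[OF F]
  show ?case
  proof (cases "G - F \<subseteq> A")
    case True
    \<comment> \<open>\<open>F\<close> is at least as large as \<open>G\<close> but has fewer
      elements in \<open>A\<close>, so it has more outside \<open>A\<close>.\<close>
    have "\<not> F - A \<subseteq> G"
    proof
      assume "F - A \<subseteq> G"
      then have "card (F - A) \<le> card (G - A)" using finG by (intro card_mono) auto
      moreover have "card F = card (F \<inter> A) + card (F - A)" "card G = card (G \<inter> A) + card (G - A)"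
        using finF finG by (metis card_Diff_subset_Int card_mono finite_Int inf_le1 le_add_diff_inverse)+
      moreover have "card G \<le> card F" using matroid_bases_card_le M F less.prems(1) by blast
      ultimately show False using less.prems(2) by simp
    qed
    then obtain e where e: "e \<in> F - A" "e \<in> F - G" by blast
    then show ?thesis using ex[OF F less.prems(1) e(2)] True by blast
  next
    case False
    then obtain g where g: "g \<in> G - F" "g \<notin> A" by blast
    then obtain h where h: "h \<in> F - G" "insert h (G - {g}) \<in> \<B>" using ex[OF less.prems(1) F] by blast
    have "insert h (G - {g}) - F = (G - F) - {g}" using g h by auto
    then have "card (insert h (G - {g}) - F) < card (G - F)"
      using g(1) finG by (metis card_Diff1_less finite_Diff)
    \<comment> \<open>The element \<open>g\<close> given up lies outside \<open>A\<close>, so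
      \<open>G\<close> loses nothing there.\<close>
    moreover have "card (G \<inter> A) \<le> card (insert h (G - {g}) \<inter> A)"
      using finG g by (intro card_mono) auto
    ultimately show ?thesis using less.hyps[of "insert h (G - {g})"] h(2) less.prems(2) by simp
  qed
qed

section \<open>Minimal weightings and the decomposition for matroids\<close>

lemma wt_strict_mono:
  assumes "le_exp v u" "finite C" "e \<in> C" "Poly_Mapping.lookup v e < Poly_Mapping.lookup u e"
  shows "wt C v < wt C u"
  unfolding wt_def using assms by (intro sum_strict_mono_ex1) (auto simp: le_exp_def)

lemma le_exp_neq:
  assumes "le_exp v u" "v \<noteq> u"
  obtains e where "Poly_Mapping.lookup v e < Poly_Mapping.lookup u e"
  using assms poly_mapping_eqI[of v u] unfolding le_exp_def by (metis le_neq_implies_less)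

text \<open>Lowering \<open>t\<close> by one at \<open>e\<close> must violate the bound for some
  \<open>C\<close>; this \<open>C\<close> contains \<open>e\<close>, and \<open>t\<close> meets its
  bound with equality.\<close>

lemma mins_cov_tight:
  assumes "\<C> \<subseteq> Pow {1..n}" and t: "t \<in> mins (cov n \<C> l)" and e: "e \<in> Poly_Mapping.keys t"
  shows "\<exists>C\<in>\<C>. e \<in> C \<and> wt C t = l"
proof -
  define d where "d = Poly_Mapping.single e (1::nat)"
  have le: "le_exp d t" using e by (auto simp: d_def le_exp_def lookup_single when_def in_keys_iff)
  note td = le_exp_diff[OF le]
  have ex: "t \<in> exps n" using t by (simp add: mins_def cov_def)
  have "Poly_Mapping.lookup (t - d) e \<noteq> Poly_Mapping.lookup t e"
    using e by (simp add: d_def lookup_minus in_keys_iff)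
  then have "t - d \<noteq> t" by metis
  moreover have "le_exp (t - d) t" by (simp add: le_exp_def lookup_minus)
  ultimately have "t - d \<notin> cov n \<C> l" using t by (auto simp: mins_def)
  then obtain C where C: "C \<in> \<C>" "wt C (t - d) < l"
    using exps_diff[OF ex] by (auto simp: cov_def not_le)
  have "finite C" using C assms(1) finite_subset[of C "{1..n}"] by auto
  then have "wt C d = (if e \<in> C then 1 else 0)" by (simp add: wt_def d_def lookup_single when_def)
  moreover have "wt C t = wt C (t - d) + wt C d" using wt_add td by metis
  moreover have "l \<le> wt C t" using t C by (auto simp: mins_def cov_def)
  ultimately show ?thesis using C by (intro bexI[of _ C]) (auto split: if_splits)
qed

lemma matroid_chain_decomp:
  assumes M: "matroid_bases {1..n} \<B>" and l: "1 \<le> l"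
    and t: "t \<in> mins (cov n ((-) {1..n} ` \<B>) l)"
  shows "chain_decomp n ((-) {1..n} ` \<B>) l t"
proof -
  let ?N = "{1..n}" and ?lk = "Poly_Mapping.lookup t"
  let ?U = "cov n ((-) ?N ` \<B>)"
  have tx: "t \<in> exps n" and tw: "\<And>F. F \<in> \<B> \<Longrightarrow> l \<le> wt (?N - F) t"
    using t by (auto simp: mins_def cov_def)
  have BN: "F \<subseteq> ?N" "finite F" if "F \<in> \<B>" for F
    using M that finite_subset[of F ?N] by (auto simp: matroid_bases_def)
  have CN: "(-) ?N ` \<B> \<subseteq> Pow ?N" by auto
  have "finite \<B>" "\<B> \<noteq> {}" using M finite_subset[of \<B> "Pow ?N"] by (auto simp: matroid_bases_def)
  \<comment> \<open>Level sets of the weighting. The sums start at \<open>i = 1\<close>, since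
    \<open>A 0\<close> is the whole vertex set.\<close>
  define A where "A i = {j. i \<le> ?lk j \<and> j \<in> ?N}" for i
  have Afin: "finite (A i)" and AN: "A i \<subseteq> ?N" for i by (auto simp: A_def)
  have t0: "?lk j = 0" if "j \<notin> ?N" for j using tx that by (auto simp: exps_def in_keys_iff)
  have "t \<noteq> 0"
  proof
    assume "t = 0"
    then have "wt C t = 0" for C by (simp add: wt_def)
    then show False using tw \<open>\<B> \<noteq> {}\<close> l by fastforce
  qed
  \<comment> \<open>The largest value of \<open>t\<close>, hence the number of nonempty level sets
    of positive index; the vertex \<open>j0\<close> attaining it lies in all of them.\<close>
  define s where "s = Max (?lk ` Poly_Mapping.keys t)"
  have kne: "Poly_Mapping.keys t \<noteq> {}" using \<open>t \<noteq> 0\<close> by simp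
  have sle: "?lk j \<le> s" for j
    by (cases "j \<in> Poly_Mapping.keys t") (auto simp: s_def in_keys_iff)
  have "s \<in> ?lk ` Poly_Mapping.keys t" unfolding s_def using kne by (intro Max_in) auto
  then obtain j0 where j0: "j0 \<in> Poly_Mapping.keys t" "?lk j0 = s" by blast
  then have j0A: "j0 \<in> A i" if "i \<le> s" for i using that t0 by (force simp: A_def in_keys_iff)
  have tsum: "t = (\<Sum>i=1..s. ind (A i))"
  proof (rule poly_mapping_eqI)
    fix j
    have "Poly_Mapping.lookup (\<Sum>i=1..s. ind (A i)) j = (\<Sum>i=1..s. if j \<in> A i then 1 else 0)"
      by (simp add: lookup_sum lookup_ind Afin)
    also have "\<dots> = card ({1..s} \<inter> {i. j \<in> A i})" by (simp add: sum.If_cases)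
    also have "{1..s} \<inter> {i. j \<in> A i} = {1..?lk j}"
      using sle[of j] t0[of j] by (cases "j \<in> ?N") (auto simp: A_def)
    finally show "?lk j = Poly_Mapping.lookup (\<Sum>i=1..s. ind (A i)) j" by simp
  qed
  have wtsum: "wt C t = (\<Sum>i=1..s. card (C \<inter> A i))" if "finite C" for C
  proof -
    have "wt C (\<Sum>i\<in>X. ind (A i)) = (\<Sum>i\<in>X. card (C \<inter> A i))" for X
      using that Afin by (induction X rule: infinite_finite_induct) (auto simp: wt_add wt_ind wt_def[of _ 0])
    then show ?thesis using tsum by simp
  qed
  \<comment> \<open>A basis of maximal weight, so that its complement has minimal weight.\<close>
  obtain F0 where F0: "F0 \<in> \<B>" and F0max: "\<And>F. F \<in> \<B> \<Longrightarrow> wt F t \<le> wt F0 t"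
  proof -
    have "Max ((\<lambda>F. wt F t) ` \<B>) \<in> (\<lambda>F. wt F t) ` \<B>" using \<open>finite \<B>\<close> \<open>\<B> \<noteq> {}\<close> by (intro Max_in) auto
    then obtain F0 where "F0 \<in> \<B>" "wt F0 t = Max ((\<lambda>F. wt F t) ` \<B>)" by auto
    then show ?thesis using that[of F0] \<open>finite \<B>\<close> by simp
  qed
  have greedy: "card (G \<inter> A i) \<le> card (F0 \<inter> A i)" if G: "G \<in> \<B>" for G i
  proof (rule ccontr)
    assume "\<not> ?thesis"
    then obtain e f where e: "e \<in> F0 - A i" and f: "f \<in> A i - F0" and ex: "insert f (F0 - {e}) \<in> \<B>"
      using matroid_bases_exchange_into[OF M F0 G, of "A i"] by (auto simp: not_le)
    \<comment> \<open>\<open>e\<close> is below level \<open>i\<close> and \<open>f\<close> is not,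
      so the exchange would increase the maximal weight.\<close>
    have "?lk e < ?lk f" using e f BN(1)[OF F0] by (auto simp: A_def)
    moreover have "wt (insert f (F0 - {e})) t = ?lk f + wt (F0 - {e}) t"
      using f BN[OF F0] by (simp add: wt_def)
    moreover have "wt F0 t = ?lk e + wt (F0 - {e}) t"
      using e BN[OF F0] unfolding wt_def by (intro sum.remove) auto
    ultimately show False using F0max[OF ex] by simp
  qed
  define c where "c i = card ((?N - F0) \<inter> A i)" for i
  have cle: "c i \<le> card ((?N - G) \<inter> A i)" if G: "G \<in> \<B>" for G i
  proof -
    have *: "card (A i) = card (H \<inter> A i) + card ((?N - H) \<inter> A i)" for H
    proof -
      have "A i = (H \<inter> A i) \<union> ((?N - H) \<inter> A i)" using AN[of i] by blast
      then show ?thesis using card_Un_disjoint[of "H \<inter> A i" "(?N - H) \<inter> A i"] Afin[of i] by fastforce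
    qed
    show ?thesis using *[of G] *[of F0] greedy[OF G, of i] by (simp add: c_def)
  qed
  have tight: "\<exists>G\<in>\<B>. e \<in> ?N - G \<and> wt (?N - G) t = l \<and> (\<forall>i\<in>{1..s}. card ((?N - G) \<inter> A i) = c i)"
    if e: "e \<in> Poly_Mapping.keys t" for e
  proof -
    obtain G where G: "G \<in> \<B>" "e \<in> ?N - G" "wt (?N - G) t = l"
      using mins_cov_tight[OF CN t e] by blast
    \<comment> \<open>The weight of the complement of \<open>G\<close> is \<open>l\<close>, so
      \<open>l\<close> is both a lower and an upper bound for the sum of the \<open>c i\<close>.
      Equality then holds term by term: all level sets attain their minima on this
      complement.\<close>
    have "l \<le> (\<Sum>i=1..s. c i)" using tw[OF F0] wtsum[of "?N - F0"] by (simp add: c_def)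
    moreover have "(\<Sum>i=1..s. card ((?N - G) \<inter> A i)) = l" using G wtsum[of "?N - G"] by simp
    moreover have "(\<Sum>i=1..s. c i) \<le> (\<Sum>i=1..s. card ((?N - G) \<inter> A i))" by (intro sum_mono cle G)
    ultimately have "(\<Sum>i=1..s. c i) = (\<Sum>i=1..s. card ((?N - G) \<inter> A i))" by simp
    then have "\<forall>i\<in>{1..s}. c i = card ((?N - G) \<inter> A i)"
      using sum_mono_inv[of c "{1..s}" "\<lambda>i. card ((?N - G) \<inter> A i)"] cle[OF G(1)] by blast
    then show ?thesis using G by auto
  qed
  have "1 \<le> c i \<and> sqf (ind (A i)) \<and> ind (A i) \<in> mins (?U (c i))" if i: "i \<in> {1..s}" for i
  proof (intro conjI)
    obtain G where G: "j0 \<in> ?N - G" "card ((?N - G) \<inter> A i) = c i"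
      using tight[OF j0(1)] i by blast
    \<comment> \<open>\<open>j0\<close> lies both in this complement and in every level set.\<close>
    then have "(?N - G) \<inter> A i \<noteq> {}" using j0A[of i] i by auto
    then show "1 \<le> c i" using G(2) by (metis One_nat_def Suc_leI card_gt_0_iff finite_Int Afin)
    show "sqf (ind (A i))" by (rule sqf_ind[OF Afin])
    have "ind (A i) \<in> ?U (c i)"
      using cle ind_exps[OF AN] by (auto simp: cov_def wt_ind Afin)
    moreover have "v = ind (A i)" if v: "v \<in> ?U (c i)" "le_exp v (ind (A i))" for v
    proof (rule ccontr)
      assume "v \<noteq> ind (A i)"
      \<comment> \<open>If \<open>v\<close> drops at \<open>e\<close>, it falls below
        \<open>c i\<close> on a complement through \<open>e\<close> where \<open>A i\<close> attains
        its minimum.\<close>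
      then obtain e where e: "Poly_Mapping.lookup v e < Poly_Mapping.lookup (ind (A i)) e"
        using v(2) le_exp_neq by blast
      then have "e \<in> A i" by (auto simp: lookup_ind Afin split: if_splits)
      then have "e \<in> Poly_Mapping.keys t" using i by (auto simp: A_def in_keys_iff)
      then obtain G where G: "G \<in> \<B>" "e \<in> ?N - G" "card ((?N - G) \<inter> A i) = c i"
        using tight i by blast
      have "c i \<le> wt (?N - G) v" using v(1) G(1) by (auto simp: cov_def)
      also have "\<dots> < wt (?N - G) (ind (A i))" using v(2) e G(2) by (intro wt_strict_mono) auto
      finally show False using G(3) by (simp add: wt_ind Afin)
    qed
    ultimately show "ind (A i) \<in> mins (?U (c i))" by (auto simp: mins_def)
  qed
  moreover have "(\<Sum>i=1..s. c i) = l"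
    using tight[OF j0(1)] wtsum by auto
  moreover have "\<forall>i. 1 \<le> i \<and> i < s \<longrightarrow> Poly_Mapping.keys (ind (A (Suc i))) \<subseteq> Poly_Mapping.keys (ind (A i))"
    by (auto simp: keys_ind Afin) (auto simp: A_def)
  ultimately show ?thesis unfolding chain_decomp_def using tsum by blast
qed

section \<open>Circuits, elimination and augmentation\<close>

definition circuit :: "nat \<Rightarrow> nat set set \<Rightarrow> nat set \<Rightarrow> bool" where
  "circuit n \<Delta> K \<longleftrightarrow> K \<subseteq> {1..n} \<and> K \<notin> \<Delta> \<and> (\<forall>S. S \<subset> K \<longrightarrow> S \<in> \<Delta>)"

lemma nonface_contains_circuit:
  assumes "S \<subseteq> {1..n}" "S \<notin> \<Delta>"
  shows "\<exists>K\<subseteq>S. circuit n \<Delta> K"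
proof -
  have "finite S" using assms finite_subset by blast
  then show ?thesis using assms
  proof (induction S rule: finite_psubset_induct)
    case (psubset S)
    show ?case
    proof (cases "\<exists>T. T \<subset> S \<and> T \<notin> \<Delta>")
      case True
      then obtain T where T: "T \<subset> S" "T \<notin> \<Delta>" by blast
      then have "T \<subseteq> {1..n}" using psubset.prems by blast
      then show ?thesis using psubset.IH[OF T(1)] T by blast
    next
      case False
      then show ?thesis using psubset.prems by (auto simp: circuit_def)
    qed
  qed
qed

lemma face_in_facet:
  assumes "simplicial_complex n \<Delta>" "S \<in> \<Delta>"
  obtains F where "F \<in> facets \<Delta>" "S \<subseteq> F"
proof -
  have "finite \<Delta>" using assms(1) finite_subset[of \<Delta> "Pow {1..n}"] by (auto simp: simplicial_complex_def)
  then obtain F where F: "F \<in> \<Delta>" "S \<subseteq> F" "\<And>F'. F' \<in> \<Delta> \<Longrightarrow> F \<subseteq> F' \<Longrightarrow> F = F'"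
    using finite_has_maximal2[of \<Delta> S] assms(2) by metis
  then have "F \<in> facets \<Delta>" unfolding facets_def by blast
  then show ?thesis using that F by blast
qed

lemma clutter_facet_complements:
  assumes "simplicial_complex n \<Delta>"
  shows "clutter n ((-) {1..n} ` facets \<Delta>)"
proof -
  have "facets \<Delta> \<noteq> {}" using assms face_in_facet[OF assms]
    by (metis all_not_in_conv simplicial_complex_def)
  moreover have "{1..n} - F = {1..n} - G"
    if F: "F \<in> facets \<Delta>" and G: "G \<in> facets \<Delta>" and sub: "{1..n} - F \<subseteq> {1..n} - G" for F G
  proof -
    have "G \<subseteq> {1..n}" "G \<in> \<Delta>" "F \<in> \<Delta>" using F G assms by (auto simp: facets_def simplicial_complex_def)
    then have "G \<subseteq> F" using sub by blast
    then have "F = G" using G \<open>F \<in> \<Delta>\<close> by (auto simp: facets_def)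
    then show ?thesis by simp
  qed
  ultimately show ?thesis unfolding clutter_def by auto
qed

text \<open>If elimination failed, the decomposition of a single weighting would produce a nonface
  inside \<open>K1 \<inter> K2\<close>.\<close>

lemma chain_decomp_circuit_elim:
  assumes D: "simplicial_complex n \<Delta>" and l: "2 \<le> l"
    and T: "\<forall>t\<in>mins (cov n ((-) {1..n} ` facets \<Delta>) l). chain_decomp n ((-) {1..n} ` facets \<Delta>) l t"
    and K1: "circuit n \<Delta> K1" and K2: "circuit n \<Delta> K2" and neq: "K1 \<noteq> K2" and e: "e \<in> K1 \<inter> K2"
  shows "K1 \<union> K2 - {e} \<notin> \<Delta>"
proof
  let ?N = "{1..n}"
  let ?U = "cov n ((-) ?N ` facets \<Delta>)"
  assume "K1 \<union> K2 - {e} \<in> \<Delta>"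
  then obtain F where F: "F \<in> facets \<Delta>" "K1 \<union> K2 - {e} \<subseteq> F" using face_in_facet[OF D] by blast
  have down: "\<And>S S'. S \<in> \<Delta> \<Longrightarrow> S' \<subseteq> S \<Longrightarrow> S' \<in> \<Delta>" using D by (auto simp: simplicial_complex_def)
  have facD: "G \<in> \<Delta>" if "G \<in> facets \<Delta>" for G using that by (simp add: facets_def)
  have K: "K1 \<subseteq> ?N" "K1 \<notin> \<Delta>" "K2 \<subseteq> ?N" "K2 \<notin> \<Delta>" using K1 K2 by (auto simp: circuit_def)
  have Kfin: "finite K1" "finite K2" using K finite_subset by blast+
  \<comment> \<open>The complement of a facet meets every nonface, because subsets of a facet are
    faces.\<close>
  have wtK: "1 \<le> wt (?N - G) (ind S)" if "G \<in> facets \<Delta>" "S \<subseteq> ?N" "S \<notin> \<Delta>" for G S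
  proof -
    have "(?N - G) \<inter> S \<noteq> {}" using that down[OF facD[OF that(1)], of S] by blast
    moreover have "finite S" using that finite_subset by blast
    ultimately show ?thesis by (simp add: wt_ind Suc_le_eq card_gt_0_iff)
  qed
  \<comment> \<open>One copy of \<open>K1\<close> and \<open>l - 1\<close> copies of
    \<open>K2\<close>: each of the \<open>l\<close> copies contributes at least 1 on every facet
    complement.\<close>
  define v where "v = ind K1 + (\<Sum>i=1..l-1. ind K2)"
  have lv: "Poly_Mapping.lookup v j = (if j \<in> K1 then 1 else 0) + (l - 1) * (if j \<in> K2 then 1 else 0)" for j
    by (simp add: v_def lookup_add lookup_sum lookup_ind Kfin del: sum_constant) simp
  have wv: "wt C v = wt C (ind K1) + (l - 1) * wt C (ind K2)" for C
    by (simp add: wt_def lv lookup_ind Kfin sum.distrib sum_distrib_left)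
  have "Poly_Mapping.keys v \<subseteq> K1 \<union> K2" by (auto simp: in_keys_iff lv split: if_splits)
  then have vx: "v \<in> exps n" using K unfolding exps_def by blast
  have "l \<le> wt (?N - G) v" if G: "G \<in> facets \<Delta>" for G
  proof -
    have "(l - 1) * 1 \<le> (l - 1) * wt (?N - G) (ind K2)"
      using wtK[OF G K(3,4)] by (intro mult_le_mono2)
    then show ?thesis using wtK[OF G K(1,2)] l unfolding wv by linarith
  qed
  then have "v \<in> ?U l" using vx by (auto simp: cov_def)
  then obtain t where t: "t \<in> mins (?U l)" "le_exp t v" using mins_below[OF upset_cov] by blast
  then obtain s u c where tu: "t = (\<Sum>i=1..s. u i)"
      and u: "\<And>i. i \<in> {1..s} \<Longrightarrow> 1 \<le> c i \<and> sqf (u i) \<and> u i \<in> mins (?U (c i))"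
      and c: "(\<Sum>i=1..s. c i) = l"
      and ch: "\<And>i. 1 \<le> i \<Longrightarrow> i < s \<Longrightarrow> Poly_Mapping.keys (u (Suc i)) \<subseteq> Poly_Mapping.keys (u i)"
    using T unfolding chain_decomp_def by blast
  have ut: "le_exp (u i) t" if "i \<in> {1..s}" for i
    unfolding tu le_exp_def lookup_sum using that by (auto intro: member_le_sum)
  have eN: "e \<in> ?N" using e K by blast
  \<comment> \<open>On the complement of \<open>F\<close> the support is contained in
    \<open>{e}\<close>, because \<open>F\<close> contains the rest of \<open>K1 \<union> K2\<close>;
    a squarefree vector has weight at most 1 there.\<close>
  have c1: "c i = 1" if i: "i \<in> {1..s}" for i
  proof -
    have "Poly_Mapping.lookup (u i) j = 0" if "j \<in> ?N - F - {e}" for j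
    proof -
      have "j \<notin> K1" "j \<notin> K2" using that F by auto
      then have "Poly_Mapping.lookup v j = 0" by (simp add: lv)
      then show ?thesis using le_exp_trans[OF ut[OF i] t(2)] unfolding le_exp_def by (metis le_zero_eq)
    qed
    then have "\<forall>j\<in>?N - F - {e}. Poly_Mapping.lookup (u i) j = 0" by blast
    then have "wt (?N - F) (u i) = (\<Sum>j\<in>(?N - F) \<inter> {e}. Poly_Mapping.lookup (u i) j)"
      unfolding wt_def by (intro sum.mono_neutral_right) (simp, blast, blast)
    also have "\<dots> \<le> (\<Sum>j\<in>(?N - F) \<inter> {e}. 1)"
      using u[OF i] by (intro sum_mono) (simp add: sqf_def)
    also have "\<dots> \<le> 1" by (simp add: Int_insert_right)
    finally have "wt (?N - F) (u i) \<le> 1" .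
    moreover have "c i \<le> wt (?N - F) (u i)" using u[OF i] F by (auto simp: mins_def cov_def)
    ultimately show ?thesis using u[OF i] by simp
  qed
  have s: "s = l" using c c1 by simp
  have keys: "Poly_Mapping.keys (u (Suc i)) \<subseteq> Poly_Mapping.keys (u 1)" if "i < s" for i
    using that
  proof (induction i)
    case (Suc i)
    then show ?case using ch[of "Suc i"] by auto
  qed simp
  have u1: "1 \<in> {1..s}" using s l by simp
  \<comment> \<open>All supports lie in that of \<open>u 1\<close>, so the squarefree
    \<open>u i\<close> is below \<open>u 1\<close>, which is minimal for the same bound 1.\<close>
  have ueq: "u i = u 1" if i: "i \<in> {1..s}" for i
  proof -
    have "u i = ind (Poly_Mapping.keys (u i))" "u 1 = ind (Poly_Mapping.keys (u 1))"
      using u i u1 by (auto intro: ind_keys)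
    moreover have "Poly_Mapping.keys (u i) \<subseteq> Poly_Mapping.keys (u 1)"
      using keys[of "i - 1"] i by (cases i) simp_all
    ultimately have "le_exp (u i) (u 1)"
      unfolding le_exp_def by (metis finite_keys lookup_ind subsetD le_refl zero_le)
    moreover have "u i \<in> ?U 1" "u 1 \<in> mins (?U 1)" using u[OF i] u[OF u1] c1[OF i] c1[OF u1] by (auto simp: mins_def)
    ultimately show ?thesis by (simp add: mins_def)
  qed
  have tl: "Poly_Mapping.lookup t j = l * Poly_Mapping.lookup (u 1) j" for j
  proof -
    have "Poly_Mapping.lookup t j = (\<Sum>i=1..s. Poly_Mapping.lookup (u i) j)" by (simp add: tu lookup_sum)
    also have "\<dots> = (\<Sum>i=1..s. Poly_Mapping.lookup (u 1) j)" by (rule sum.cong[OF refl]) (simp only: ueq)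
    finally show ?thesis using s by simp
  qed
  have "Poly_Mapping.keys (u 1) \<subseteq> K1 \<inter> K2"
  proof
    fix j assume "j \<in> Poly_Mapping.keys (u 1)"
    then have "1 \<le> Poly_Mapping.lookup (u 1) j" by (simp add: in_keys_iff Suc_le_eq)
    then have "l * 1 \<le> l * Poly_Mapping.lookup (u 1) j" by (intro mult_le_mono2)
    then have "l \<le> Poly_Mapping.lookup v j"
      using t(2) tl[of j] unfolding le_exp_def by (metis mult_1_right order_trans)
    \<comment> \<open>Outside \<open>K1 \<inter> K2\<close> the value of \<open>v\<close> is 0, 1 or
      \<open>l - 1\<close>, each less than \<open>l\<close> because
      \<open>2 \<le> l\<close>.\<close>
    then show "j \<in> K1 \<inter> K2" using l by (auto simp: lv split: if_splits)
  qed
  \<comment> \<open>The two circuits differ, so the intersection is a proper subset of at least one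
    of them.\<close>
  moreover have "K1 \<inter> K2 \<in> \<Delta>"
    using K1 K2 neq unfolding circuit_def by (metis inf.cobounded1 inf.cobounded2 psubsetI)
  ultimately have "Poly_Mapping.keys (u 1) \<in> \<Delta>" using down by blast
  then obtain G where G: "G \<in> facets \<Delta>" "Poly_Mapping.keys (u 1) \<subseteq> G" using face_in_facet[OF D] by blast
  then have "wt (?N - G) (u 1) = 0" unfolding wt_def by (intro sum.neutral) (auto simp: in_keys_iff)
  moreover have "1 \<le> wt (?N - G) (u 1)" using u[OF u1] c1[OF u1] G by (auto simp: mins_def cov_def)
  ultimately show False by simp
qed

text \<open>\<open>J3\<close> below is a face in \<open>J1 \<union> J2\<close> with more elements than \<open>J1\<close> that misses as little of \<open>J1\<close> as possible.\<close>

lemma circuit_elim_augment: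
  assumes D: "simplicial_complex n \<Delta>"
    and elim: "\<And>K1 K2 e. circuit n \<Delta> K1 \<Longrightarrow> circuit n \<Delta> K2 \<Longrightarrow> K1 \<noteq> K2 \<Longrightarrow> e \<in> K1 \<inter> K2 \<Longrightarrow> K1 \<union> K2 - {e} \<notin> \<Delta>"
    and J1: "J1 \<in> \<Delta>" and J2: "J2 \<in> \<Delta>" and card: "card J1 < card J2"
  shows "\<exists>f\<in>J2 - J1. insert f J1 \<in> \<Delta>"
proof (rule ccontr)
  assume no: "\<not> ?thesis"
  have down: "\<And>S S'. S \<in> \<Delta> \<Longrightarrow> S' \<subseteq> S \<Longrightarrow> S' \<in> \<Delta>" using D by (auto simp: simplicial_complex_def)
  have fin: "S \<subseteq> {1..n}" "finite S" if "S \<in> \<Delta>" for S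
    using D that finite_subset[of S "{1..n}"] by (auto simp: simplicial_complex_def)
  let ?Q = "\<lambda>S. S \<in> \<Delta> \<and> S \<subseteq> J1 \<union> J2 \<and> card J1 < card S"
  have "?Q J2" using J2 card by auto
  then obtain J3 where J3: "?Q J3" and min: "\<And>S. ?Q S \<Longrightarrow> card (J1 - J3) \<le> card (J1 - S)"
    using ex_has_least_nat[of ?Q J2 "\<lambda>S. card (J1 - S)"] by blast
  have "\<not> J3 \<subseteq> J1" using J3 card_mono[OF fin(2)[OF J1], of J3] by auto
  have "\<not> J1 \<subseteq> J3"
  proof
    assume "J1 \<subseteq> J3"
    obtain f where "f \<in> J3 - J1" using \<open>\<not> J3 \<subseteq> J1\<close> by blast
    \<comment> \<open>\<open>f\<close> lies in \<open>J2\<close>, so it would augment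
      \<open>J1\<close>.\<close>
    then show False using no down[of J3 "insert f J1"] J3 \<open>J1 \<subseteq> J3\<close> by blast
  qed
  then obtain e where e: "e \<in> J1" "e \<notin> J3" by blast
  have J3fin: "finite J3" using J3 fin by blast
  \<comment> \<open>Swapping \<open>f\<close> for \<open>e\<close> keeps the size of
    \<open>J3\<close> but misses less of \<open>J1\<close>, so by the choice of \<open>J3\<close>
    the result is a nonface. A circuit in it contains \<open>e\<close>, as otherwise it would lie in
    the face \<open>J3\<close>.\<close>
  have circ: "\<exists>K. circuit n \<Delta> K \<and> K \<subseteq> insert e (J3 - {f}) \<and> e \<in> K" if f: "f \<in> J3 - J1" for f
  proof -
    let ?T = "insert e (J3 - {f})"
    have "card ?T = card J3" using e f J3fin by (metis DiffE card.remove card_insert_disjoint finite_Diff)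
    moreover have "?T \<subseteq> J1 \<union> J2" using e J3 by blast
    moreover have "J1 - ?T = (J1 - J3) - {e}" using f by auto
    then have "card (J1 - ?T) < card (J1 - J3)" using e fin(2)[OF J1] by (metis DiffI card_Diff1_less finite_Diff)
    ultimately have "?T \<notin> \<Delta>" using min[of ?T] J3 by auto
    moreover have "?T \<subseteq> {1..n}" using e J3 fin(1)[OF J1] fin(1)[of J3] by blast
    ultimately obtain K where K: "K \<subseteq> ?T" "circuit n \<Delta> K"
      using nonface_contains_circuit[of ?T n \<Delta>] by auto
    moreover have "e \<in> K"
    proof (rule ccontr)
      assume "e \<notin> K"
      then have "K \<subseteq> J3" using K by auto
      then show False using K J3 down by (auto simp: circuit_def)
    qed
    ultimately show ?thesis by blast
  qed
  obtain g where g: "g \<in> J3 - J1" using \<open>\<not> J3 \<subseteq> J1\<close> by blast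
  obtain K1 where K1: "circuit n \<Delta> K1" "K1 \<subseteq> insert e (J3 - {g})" "e \<in> K1" using circ[OF g] by blast
  \<comment> \<open>This supplies \<open>h\<close> in \<open>K1\<close> outside \<open>J1\<close>.
    The circuit for the swap at \<open>h\<close> omits \<open>h\<close> and so differs from
    \<open>K1\<close>, while both contain \<open>e\<close>; eliminating \<open>e\<close> leaves a
    subset of the face \<open>J3\<close>.\<close>
  have "\<not> K1 \<subseteq> J1" using K1(1) J1 down by (auto simp: circuit_def)
  then obtain h where h: "h \<in> K1" "h \<in> J3 - J1" using K1 e by blast
  obtain K2 where K2: "circuit n \<Delta> K2" "K2 \<subseteq> insert e (J3 - {h})" "e \<in> K2" using circ[OF h(2)] by blast
  have "h \<noteq> e" using h e by blast
  then have "K1 \<noteq> K2" using h K2 by blast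
  then have "K1 \<union> K2 - {e} \<notin> \<Delta>" using elim K1 K2 by blast
  moreover have "K1 \<union> K2 - {e} \<subseteq> J3" using K1 K2 by blast
  ultimately show False using J3 down by blast
qed

text \<open>Augmentation forces all facets to have the same size. Augmenting \<open>A - {a}\<close>
  from \<open>B\<close> restores that size, so the result is a facet.\<close>

lemma augment_is_matroid:
  assumes D: "simplicial_complex n \<Delta>"
    and aug: "\<And>J1 J2. J1 \<in> \<Delta> \<Longrightarrow> J2 \<in> \<Delta> \<Longrightarrow> card J1 < card J2 \<Longrightarrow> \<exists>f\<in>J2 - J1. insert f J1 \<in> \<Delta>"
  shows "is_matroid n \<Delta>"
  unfolding is_matroid_def matroid_bases_def
proof (intro conjI ballI)
  have down: "\<And>S S'. S \<in> \<Delta> \<Longrightarrow> S' \<subseteq> S \<Longrightarrow> S' \<in> \<Delta>" using D by (auto simp: simplicial_complex_def)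
  have fin: "S \<subseteq> {1..n}" "finite S" if "S \<in> \<Delta>" for S
    using D that finite_subset[of S "{1..n}"] by (auto simp: simplicial_complex_def)
  have fD: "A \<in> \<Delta>" if "A \<in> facets \<Delta>" for A using that by (simp add: facets_def)
  have le: "card B \<le> card A" if A: "A \<in> facets \<Delta>" and B: "B \<in> facets \<Delta>" for A B
  proof (rule ccontr)
    assume "\<not> ?thesis"
    then obtain f where "f \<in> B - A" "insert f A \<in> \<Delta>" using aug[OF fD[OF A] fD[OF B]] by auto
    then show False using A unfolding facets_def by blast
  qed
  show "facets \<Delta> \<noteq> {}" using clutter_facet_complements[OF D] by (simp add: clutter_def)
  show "facets \<Delta> \<subseteq> Pow {1..n}" using fD fin(1) by blast
  fix A B a assume A: "A \<in> facets \<Delta>" and B: "B \<in> facets \<Delta>" and a: "a \<in> A - B"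
  have "card (A - {a}) < card B"
    using a le[OF B A] card_Diff1_less[OF fin(2)[OF fD[OF A]], of a] by simp
  then obtain f where f: "f \<in> B - (A - {a})" "insert f (A - {a}) \<in> \<Delta>"
    using aug[OF down[OF fD[OF A]] fD[OF B], of "A - {a}"] by blast
  \<comment> \<open>\<open>f\<close> differs from \<open>a\<close> because \<open>a\<close> is not
    in \<open>B\<close>.\<close>
  have fBA: "f \<in> B - A" using f a by blast
  obtain G where G: "G \<in> facets \<Delta>" "insert f (A - {a}) \<subseteq> G" using face_in_facet[OF D f(2)] by blast
  have "card (insert f (A - {a})) = card A"
    using a fBA fin(2)[OF fD[OF A]] by (metis DiffE card.remove card_insert_disjoint finite_Diff)
  then have "insert f (A - {a}) = G"
    using G le[OF A G(1)] fin(2)[OF fD[OF G(1)]] by (intro card_seteq) auto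
  then show "\<exists>b\<in>B - A. insert b (A - {a}) \<in> facets \<Delta>" using G fBA by blast
qed simp

section \<open>The second symbolic power\<close>

text \<open>For the bound 1 only the support matters: its indicator satisfies the same constraints
  and lies below \<open>u\<close>.\<close>

lemma mins_cov_1_sqf:
  assumes cl: "clutter n \<C>" and u: "u \<in> mins (cov n \<C> 1)"
  shows "sqf u"
proof -
  let ?v = "ind (Poly_Mapping.keys u)"
  have fin: "finite C" if "C \<in> \<C>" for C
    using cl that finite_subset[of C "{1..n}"] by (auto simp: clutter_def)
  have le: "le_exp ?v u" by (auto simp: le_exp_def lookup_ind in_keys_iff)
  have "?v \<in> exps n" using u exps_mono[OF le] by (simp add: mins_def cov_def)
  moreover have "1 \<le> wt C ?v" if C: "C \<in> \<C>" for C
  proof -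
    have "wt C u \<noteq> 0" using u C by (auto simp: mins_def cov_def)
    then have "\<exists>i\<in>C. i \<in> Poly_Mapping.keys u" unfolding wt_def in_keys_iff by (meson sum.neutral)
    then have "C \<inter> Poly_Mapping.keys u \<noteq> {}" by blast
    then show ?thesis using fin[OF C] by (simp add: wt_ind Suc_le_eq card_gt_0_iff)
  qed
  ultimately have "?v \<in> cov n \<C> 1" by (simp add: cov_def)
  then have "?v = u" using u le by (simp add: mins_def)
  then show ?thesis using sqf_ind[of "Poly_Mapping.keys u"] by simp
qed

text \<open>Through each vertex \<open>e\<close> of the support passes some \<open>C\<close> with
  \<open>wt C u = 1\<close>; there \<open>u + u\<close> has weight exactly 2, which leaves no room
  to drop at \<open>e\<close>.\<close>

lemma double_mem_mins_cov_2:
  assumes cl: "clutter n \<C>" and u: "u \<in> mins (cov n \<C> 1)"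
  shows "u + u \<in> mins (cov n \<C> 2)"
proof -
  have "2 \<le> wt C (u + u)" if "C \<in> \<C>" for C
    using u that by (force simp: mins_def cov_def wt_add)
  then have "u + u \<in> cov n \<C> 2" using u by (simp add: cov_def mins_def)
  moreover have "r = u + u" if r: "r \<in> cov n \<C> 2" "le_exp r (u + u)" for r
  proof (rule ccontr)
    assume "r \<noteq> u + u"
    then obtain e where e: "Poly_Mapping.lookup r e < Poly_Mapping.lookup (u + u) e"
      using r(2) le_exp_neq by blast
    then have "e \<in> Poly_Mapping.keys u" by (auto simp: lookup_add in_keys_iff)
    then obtain C where C: "C \<in> \<C>" "e \<in> C" "wt C u = 1"
      using mins_cov_tight[OF _ u, of e] cl unfolding clutter_def by blast
    have "finite C" using cl C finite_subset[of C "{1..n}"] by (auto simp: clutter_def)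
    then have "wt C r < wt C (u + u)" using e r(2) C by (intro wt_strict_mono)
    moreover have "2 \<le> wt C r" using r C by (simp add: cov_def)
    ultimately show False using C by (simp add: wt_add)
  qed
  ultimately show ?thesis by (auto simp: mins_def)
qed

text \<open>Each \<open>c i\<close> is positive, so there are at most two factors. One factor is a
  squarefree generator; two factors both have \<open>c i = 1\<close>, and being nested and minimal
  they are equal.\<close>

lemma chain_decomp_2_iff:
  assumes cl: "clutter n \<C>"
  shows "(\<forall>t\<in>mins (cov n \<C> 2). chain_decomp n \<C> 2 t) \<longleftrightarrow>
    mins (cov n \<C> 2) = (\<lambda>u. u + u) ` mins (cov n \<C> 1) \<union> {t \<in> mins (cov n \<C> 2). sqf t}"
    (is "?T \<longleftrightarrow> ?E")
proof
  assume T: ?T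
  have "sqf t \<or> (\<exists>u\<in>mins (cov n \<C> 1). t = u + u)" if t: "t \<in> mins (cov n \<C> 2)" for t
  proof -
    obtain s u c where tu: "t = (\<Sum>i=1..s. u i)"
      and u: "\<And>i. i \<in> {1..s} \<Longrightarrow> 1 \<le> c i \<and> sqf (u i) \<and> u i \<in> mins (cov n \<C> (c i))"
      and c: "(\<Sum>i=1..s. c i) = (2::nat)"
      and ch: "\<And>i. 1 \<le> i \<Longrightarrow> i < s \<Longrightarrow> Poly_Mapping.keys (u (Suc i)) \<subseteq> Poly_Mapping.keys (u i)"
      using T t unfolding chain_decomp_def by blast
    have "(\<Sum>i=1..s. 1) \<le> (\<Sum>i=1..s. c i)" using u by (intro sum_mono) blast
    then have "s \<le> 2" using c by simp
    moreover have "s \<noteq> 0" using c by (cases s) auto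
    ultimately consider "s = 1" | "s = 2" by linarith
    then show ?thesis
    proof cases
      case 1
      then show ?thesis using tu u[of 1] by simp
    next
      case 2
      have s2: "{1..s} = {1, 2}" using 2 by auto
      have u12: "1 \<le> c 1" "sqf (u 1)" "u 1 \<in> mins (cov n \<C> (c 1))"
        "1 \<le> c 2" "sqf (u 2)" "u 2 \<in> mins (cov n \<C> (c 2))"
        using u[of 1] u[of 2] 2 by simp_all
      have c12: "c 1 = 1" "c 2 = 1" using c u12(1,4) unfolding s2 by auto
      have "Poly_Mapping.keys (u 2) \<subseteq> Poly_Mapping.keys (u 1)"
        using ch[of 1] 2 by (simp add: numeral_2_eq_2)
      then have "le_exp (u 2) (u 1)"
        using ind_keys[OF u12(2)] ind_keys[OF u12(5)]
        unfolding le_exp_def by (metis finite_keys lookup_ind subsetD le_refl zero_le)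
      then have "u 2 = u 1" using u12(3,6) c12 by (simp add: mins_def)
      then show ?thesis using tu u12 c12 unfolding s2 by auto
    qed
  qed
  then show ?E using double_mem_mins_cov_2[OF cl] by blast
next
  assume E: ?E
  show ?T
  proof
    fix t assume t: "t \<in> mins (cov n \<C> 2)"
    then consider "sqf t" | u where "u \<in> mins (cov n \<C> 1)" "t = u + u" using E by blast
    then show "chain_decomp n \<C> 2 t"
    proof cases
      case 1
      then show ?thesis unfolding chain_decomp_def using t
        by (intro exI[of _ "1::nat"] exI[of _ "\<lambda>_. t"] exI[of _ "\<lambda>_. 2::nat"]) auto
    next
      case 2
      have "t = (\<Sum>i=1..2::nat. u)" using 2 by (simp add: numeral_2_eq_2 del: sum_constant)
      then show ?thesis unfolding chain_decomp_def using 2(1) mins_cov_1_sqf[OF cl]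
        by (intro exI[of _ "2::nat"] exI[of _ "\<lambda>_. u"] exI[of _ "\<lambda>_. 1::nat"]) simp
    qed
  qed
qed

theorem theorem1p3:
  fixes n :: nat and \<Delta> :: "nat set set" and I :: "'k::field mpoly set"
  assumes "simplicial_complex n \<Delta>"
    and "I = stanley_reisner n \<Delta>"
  shows "(is_matroid n \<Delta> \<longleftrightarrow> (\<forall>l\<ge>1. cond_T n I l))
    \<and> ((\<forall>l\<ge>1. cond_T n I l) \<longleftrightarrow> (\<exists>l\<ge>2. cond_T n I l))
    \<and> ((\<exists>l\<ge>2. cond_T n I l) \<longleftrightarrow>
        mingens n (symb_pow (poly_ring n) I 2) = (\<lambda>m. m ^ 2) ` mingens n I \<union> mingens n (SF2 n I))"
proof -
  let ?C = "(-) {1..n} ` facets \<Delta>"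
  have cl: "clutter n ?C" by (rule clutter_facet_complements[OF assms(1)])
  have I: "I = (\<Inter>C\<in>?C. var_prime n C)" using assms(2) by (simp add: stanley_reisner_def)
  note T = cond_T_iff[OF cl I]
  have 12: "cond_T n I l" if "is_matroid n \<Delta>" "1 \<le> l" for l
    using matroid_chain_decomp[of n "facets \<Delta>" l] that by (simp add: T is_matroid_def)
  have 31: "is_matroid n \<Delta>" if "2 \<le> l" "cond_T n I l" for l
    using that circuit_elim_augment[OF assms(1)] chain_decomp_circuit_elim[OF assms(1)]
    by (intro augment_is_matroid[OF assms(1)]) (simp add: T)
  have "mingens n (symb_pow (poly_ring n) I 2) = mon ` mins (cov n ?C 2)"
    unfolding I symb_pow_INT_var_prime[OF cl] by (rule mingens_mspan[OF upset_cov])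
  moreover have "mingens n I = mon ` mins (cov n ?C 1)"
    unfolding I INT_var_prime[OF cl] by (rule mingens_mspan[OF upset_cov])
  then have "(\<lambda>m. m ^ 2) ` mingens n I = mon ` (\<lambda>u. u + u) ` mins (cov n ?C 1)"
    by (simp add: image_image sq_mon)
  moreover have "mingens n (SF2 n I) = mon ` {t \<in> mins (cov n ?C 2). sqf t}"
    by (rule SF2_mingens[OF cl I])
  ultimately have "mingens n (symb_pow (poly_ring n) I 2) = (\<lambda>m. m ^ 2) ` mingens n I \<union> mingens n (SF2 n I)
    \<longleftrightarrow> mins (cov n ?C 2) = (\<lambda>u. u + u) ` mins (cov n ?C 1) \<union> {t \<in> mins (cov n ?C 2). sqf t}"
    by (simp add: inj_image_eq_iff[OF inj_mon] flip: image_Un)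
  then have 4: "mingens n (symb_pow (poly_ring n) I 2) = (\<lambda>m. m ^ 2) ` mingens n I \<union> mingens n (SF2 n I)
    \<longleftrightarrow> cond_T n I 2"
    unfolding T chain_decomp_2_iff[OF cl] .
  have 23: "\<exists>l\<ge>2. cond_T n I l" if "\<forall>l\<ge>1. cond_T n I l"
    using that by (intro exI[of _ 2]) simp
  have 13: "cond_T n I 2" if "is_matroid n \<Delta>"
    using 12[OF that] by simp
  \<comment> \<open>The facts \<open>12\<close>, \<open>23\<close> and \<open>31\<close> close a
    cycle through the first three conditions. The fourth is \<open>cond_T n I 2\<close>, which
    follows from the first and is an instance of the third.\<close>
  show ?thesis unfolding 4 using 12 31 23 13 by (meson order_refl)
qed

end
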